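(* There exists a universal constant $C>0$ such that the following holds for all real numbers $d,A$ satisfying, with $\mu:=Ad$, $$0<d<\frac{20}{399},\qquad \sqrt{1+4d^2}<\mu\le 1+\frac{d}{10},$$ every unit vector $p=(p_1,p_2)\in\mathbb R^2$, and every $u_0\in C(\mathbb T^2_{2\pi})$. Let $r_\mu:=\arccos(1/\mu)$, $\mathcal D_\mu:=[\pi-r_\mu,\pi+r_\mu]\times\{0\}$, $x_{\mathrm f}:=(\pi/2,0)$, $m=\min u_0$, $M=\max u_0$. Let $G_+^p$ and $G_{+,u_0}^p$ be the viscosity solutions of $G_t+H_+(x,DG)=0$ on $\mathbb R^2\times(0,\infty)$ with initial data $G_+^p(x,0)=p\cdot x$ and $G_{+,u_0}^p(x,0)=p\cdot x+u_0(x)$, respectively, where $$H_+(x,q)=\left(1+d\,\frac{q^{\mathsf T}S_{V_A}(x)q}{|q|^2}\right)_+|q|+V_A(x)\cdot q\quad(q\ne0),\qquad H_+(x,0)=0.$$ Then, for all $x\in\mathbb R^2$, $t\ge0$, $$G_+^p(x,t)+m\le G_{+,u_0}^p(x,t)\le G_+^p(x,t)+M.$$ Hence $$G_{+,u_0}^p(x,t)\ge\pi p_1-r_\mu|p_1|+m\qquad(x\in\mathcal D_\mu,\ t\ge0),$$ $$\liminf_{t\to\infty}-\frac{G_{+,u_0}^p(x_{\mathrm f},t)}{t}\ge C\frac{A}{\log A},$$ and, with $u(x,t)=G_{+,u_0}^p(x,t)-p\cdot x$, $$\liminf_{t\to\infty}\frac{\operatorname{osc}_{\mathbb T^2_{2\pi}}u(\cdot,t)}{t}\ge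 C\frac{A}{\log A}.$$
   Context: $\mathbb T^2_{2\pi}=(\mathbb R/2\pi\mathbb Z)^2$; functions on it are identified with $2\pi\mathbb Z^2$-periodic functions on $\mathbb R^2$. The cellular flow is $V_0(x_1,x_2)=(-\sin x_1\cos x_2,\ \cos x_1\sin x_2)$ and $V_A=AV_0$. For a $C^1$ vector field $V$, $S_V=(DV+DV^{\mathsf T})/2$; here $S_{V_A}(x)=A\,\mathrm{diag}(-\Phi(x),\Phi(x))$ with $\Phi(x)=\cos x_1\cos x_2$. $(a)_+=\max\{a,0\}$. $\operatorname{osc}f=\sup f-\inf f$. "The viscosity solution" with initial datum $p\cdot x+u_0(x)$ means the unique continuous viscosity solution on $\mathbb R^2\times[0,\infty)$ in the planar periodic class, i.e. such that $G(x,t)-p\cdot x$ is $2\pi\mathbb Z^2$-periodic in $x$. Convention: an upper semicontinuous $G$ is a viscosity subsolution of $G_t+H(x,DG)=0$ if $\varphi_t+H(x_0,D\varphi)\le0$ at $(x_0,t_0)$, $t_0>0$, whenever $\varphi\in C^1$ and $G-\varphi$ has a local maximum at $(x_0,t_0)$; a lower semicontinuous $G$ is a supersolution if the reverse inequality holds at local minima; a solution is both. *)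

theory Defs
  imports "HOL-Analysis.Analysis"
begin

definition cell_flow :: "real \<Rightarrow> real^2 \<Rightarrow> real^2" where
  "cell_flow A x = A *\<^sub>R vector [- (sin (x$1) * cos (x$2)), cos (x$1) * sin (x$2)]"

definition strain :: "(real^2 \<Rightarrow> real^2) \<Rightarrow> real^2 \<Rightarrow> real^2^2" where
  "strain V x = (1/2) *\<^sub>R (jacobian V (at x) + transpose (jacobian V (at x)))"

definition H_plus :: "real \<Rightarrow> real \<Rightarrow> real^2 \<Rightarrow> real^2 \<Rightarrow> real" where
  "H_plus d A x q =
     (if q = 0 then 0
      else max (1 + d * (q \<bullet> (strain (cell_flow A) x *v q)) / (norm q)^2) 0 * norm q
             + cell_flow A x \<bullet> q)"

text \<open>The explicit form of the strain tensor confirms the matrix index conventions.\<close>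

lemma cell_flow_has_derivative:
  "(cell_flow A has_derivative
     (\<lambda>h. A *\<^sub>R vector [- (cos (x$1) * cos (x$2)) * h$1 + sin (x$1) * sin (x$2) * h$2,
                     - (sin (x$1) * sin (x$2)) * h$1 + cos (x$1) * cos (x$2) * h$2])) (at x)"
proof -
  have nth: "((\<lambda>y. y $ i) has_derivative (\<lambda>h. h $ i)) (at x)" for i :: 2
    by (rule bounded_linear_imp_has_derivative) (rule bounded_linear_vec_nth)
  have vec: "vector [a, b] = a *\<^sub>R axis 1 1 + b *\<^sub>R (axis 2 1 :: real^2)" for a b :: real
    by (simp add: vec_eq_iff forall_2 axis_def)
  show ?thesis
    unfolding cell_flow_def[abs_def] vec
    by (rule derivative_eq_intros nth refl)+ (simp add: fun_eq_iff algebra_simps)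
qed

lemma strain_cell_flow:
  "strain (cell_flow A) x =
     vector [vector [- (A * (cos (x$1) * cos (x$2))), 0],
             vector [0, A * (cos (x$1) * cos (x$2))]]"
proof -
  note D = frechet_derivative_at[OF cell_flow_has_derivative[of A x], symmetric]
  show ?thesis
    unfolding strain_def jacobian_def D
    by (simp add: vec_eq_iff forall_2 matrix_def transpose_def axis_def algebra_simps)
qed

definition usc_on :: "'a::topological_space set \<Rightarrow> ('a \<Rightarrow> real) \<Rightarrow> bool" where
  "usc_on S f \<longleftrightarrow> (\<forall>z\<in>S. \<forall>a > f z. eventually (\<lambda>w. f w < a) (at z within S))"

definition lsc_on :: "'a::topological_space set \<Rightarrow> ('a \<Rightarrow> real) \<Rightarrow> bool" where
  "lsc_on S f \<longleftrightarrow> (\<forall>z\<in>S. \<forall>a < f z. eventually (\<lambda>w. a < f w) (at z within S))"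

text \<open>The equation is \<open>G\<^sub>t + H(x, DG) = 0\<close>. Test functions are \<open>C\<^sup>1\<close> on the open set \<open>\<real>\<^sup>2 \<times> (0,\<infinity>)\<close>, where all touching points
  lie; the gradient \<open>D\<close> pairs the spatial gradient (first component) with the time
  derivative (second component).\<close>

definition C1_test :: "((real^2) \<times> real \<Rightarrow> real) \<Rightarrow> ((real^2) \<times> real \<Rightarrow> (real^2) \<times> real) \<Rightarrow> bool" where
  "C1_test \<phi> D \<longleftrightarrow>
     (\<forall>z \<in> UNIV \<times> {0<..}. GDERIV \<phi> z :> D z) \<and> continuous_on (UNIV \<times> {0<..}) D"

definition visc_subsolution ::
    "(real^2 \<Rightarrow> real^2 \<Rightarrow> real) \<Rightarrow> ((real^2) \<times> real \<Rightarrow> real) \<Rightarrow> bool" where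
  "visc_subsolution H G \<longleftrightarrow>
     usc_on (UNIV \<times> {0..}) G \<and>
     (\<forall>\<phi> D x t. C1_test \<phi> D \<longrightarrow> t > 0 \<longrightarrow>
        (\<forall>\<^sub>F z in nhds (x, t). G z - \<phi> z \<le> G (x, t) - \<phi> (x, t)) \<longrightarrow>
        snd (D (x, t)) + H x (fst (D (x, t))) \<le> 0)"

definition visc_supersolution ::
    "(real^2 \<Rightarrow> real^2 \<Rightarrow> real) \<Rightarrow> ((real^2) \<times> real \<Rightarrow> real) \<Rightarrow> bool" where
  "visc_supersolution H G \<longleftrightarrow>
     lsc_on (UNIV \<times> {0..}) G \<and>
     (\<forall>\<phi> D x t. C1_test \<phi> D \<longrightarrow> t > 0 \<longrightarrow>
        (\<forall>\<^sub>F z in nhds (x, t). G z - \<phi> z \<ge> G (x, t) - \<phi> (x, t)) \<longrightarrow>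
        snd (D (x, t)) + H x (fst (D (x, t))) \<ge> 0)"

definition torus_periodic :: "(real^2 \<Rightarrow> real) \<Rightarrow> bool" where
  "torus_periodic f \<longleftrightarrow> (\<forall>x. \<forall>k :: int^2. f (x + (\<chi> i. 2 * pi * of_int (k$i))) = f x)"

text \<open>\<open>G\<close> is a continuous viscosity solution with datum \<open>p \<bullet> x + u\<^sub>0(x)\<close> such that
  \<open>G(x,t) - p \<bullet> x\<close> is periodic in \<open>x\<close>. Values of \<open>G\<close> at negative times play no role.\<close>

definition planar_visc_solution ::
    "(real^2 \<Rightarrow> real^2 \<Rightarrow> real) \<Rightarrow> real^2 \<Rightarrow> (real^2 \<Rightarrow> real) \<Rightarrow> ((real^2) \<times> real \<Rightarrow> real) \<Rightarrow> bool" where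
  "planar_visc_solution H p u\<^sub>0 G \<longleftrightarrow>
     continuous_on (UNIV \<times> {0..}) G \<and>
     visc_subsolution H G \<and> visc_supersolution H G \<and>
     (\<forall>t\<ge>0. torus_periodic (\<lambda>x. G (x, t) - p \<bullet> x)) \<and>
     (\<forall>x. G (x, 0) = p \<bullet> x + u\<^sub>0 x)"

text \<open>Functions on the torus are periodic functions on the plane, so the supremum and infimum
  over the torus are those over the plane; for continuous periodic functions both are finite.\<close>

definition osc :: "(real^2 \<Rightarrow> real) \<Rightarrow> real" where
  "osc f = (SUP x. f x) - (INF x. f x)"

definition flat_segment :: "real \<Rightarrow> (real^2) set" where
  "flat_segment \<mu> = {x. x$1 \<in> {pi - arccos (1/\<mu>) .. pi + arccos (1/\<mu>)} \<and> x$2 = 0}"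

end

theory Submission
  imports Defs
begin

text \<open>
  The argument has three ingredients, all proved by penalised doubling of variables with purely
  quadratic test functions. Write \<open>\<Phi>(x) = cos x\<^sub>1 cos x\<^sub>2\<close> and \<open>V = V\<^sub>A\<close>. The Hamiltonian is explicitly
  \<open>H(x,q) = max (1 - \<mu> \<Phi>(x) (q\<^sub>1\<^sup>2 - q\<^sub>2\<^sup>2) / |q|\<^sup>2) 0 |q| + V(x) \<bullet> q\<close>; it is Lipschitz in \<open>x\<close> with constant
  proportional to \<open>|q|\<close>, but neither convex nor concave in \<open>q\<close>.

  \<^item> Comparison (\<open>planar_comparison\<close>): the difference of two solutions in the same planar
    class is bounded by its initial supremum. This gives the two-sided bound by the affine solution.

  \<^item> The segment is a barrier (\<open>supersolution_barrier\<close>, \<open>H_plus_flat_segment_nonpos\<close>). If \<open>q\<close> is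
    normal to the segment at \<open>x\<close>, pointing inward, then \<open>H(x,q) \<le> 0\<close>: for vertical \<open>q\<close> the strain
    removes all propagation because \<open>\<mu> |\<Phi>| \<ge> 1\<close> there, and at an endpoint the propagation term is at
    most \<open>2 |q\<^sub>1|\<close>, which the outward drift term \<open>A sin r\<^sub>\<mu> |q\<^sub>1| = (sqrt (\<mu>\<^sup>2 - 1) / d) |q\<^sub>1|\<close> beats exactly when
    \<open>sqrt (1 + 4 d\<^sup>2) < \<mu>\<close>. Hence the minimum of a supersolution over the segment never falls
    below its initial value.

  \<^item> Fast transport along the separatrices (\<open>transport\<close>, \<open>follow_edges\<close>). Bounding the strain
    term by its modulus, \<open>H(x,q) \<ge> V(x) \<bullet> q + max (1 - \<mu> |\<Phi>(x)|) 0 |q|\<close>, so a solution does not increase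
    along any curve moving with velocity \<open>V + a\<close>, \<open>|a| \<le> max (1 - \<mu> |\<Phi>|) 0\<close>. Near the midpoint of a
    cell edge \<open>|\<Phi>| \<le> 1/2\<close>, and a curve can leave the separatrix to a distance of order \<open>1/A\<close> within a
    time of order \<open>1/A\<close>. It then follows an exact streamline past a hyperbolic stagnation point, which
    takes a time of order \<open>log A / A\<close>, and returns to the separatrix at the midpoint of an outgoing
    edge. At each such point both turns are possible from both incoming edges. Walks with at
    most eight such steps lead from \<open>(\<pi>/2, 0)\<close> to each of its four neighbouring translates by the
    period. By periodicity of \<open>G - p \<bullet> x\<close>, the value at \<open>(\<pi>/2, 0)\<close> therefore drops by at least \<open>\<pi>\<close>
    after each lapse of a fixed delay, which is at most a multiple of \<open>log A / A\<close>.

  The last bound follows since the solution minus \<open>p \<bullet> x\<close> is bounded below at \<open>(\<pi>, 0)\<close>, a point of the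
  segment, and decays linearly at \<open>(\<pi>/2, 0)\<close>.
\<close>

section \<open>Penalisation and quadratic test functions\<close>

text \<open>The abstract core of the doubling arguments: maximisers of \<open>F - k N\<close> for \<open>k \<rightarrow> \<infinity>\<close> accumulate at a
  maximiser of \<open>F\<close> on the zero set of \<open>N\<close>, and the penalty itself vanishes in the limit.\<close>

lemma penalization:
  fixes Z :: "'a::metric_space set" and F N :: "'a \<Rightarrow> real"
  assumes Z: "compact Z" and F: "continuous_on Z F" and N: "continuous_on Z N"
    and N0: "\<And>z. 0 \<le> N z" and z0: "z0 \<in> Z" "N z0 = 0"
  obtains k :: "nat \<Rightarrow> real" and z :: "nat \<Rightarrow> 'a" and zs :: 'a
  where "\<And>n. 0 < k n" "\<And>n. z n \<in> Z"
    "\<And>n w. w \<in> Z \<Longrightarrow> F w - k n * N w \<le> F (z n) - k n * N (z n)"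
    "z \<longlonglongrightarrow> zs" "zs \<in> Z" "N zs = 0"
    "\<And>w. w \<in> Z \<Longrightarrow> N w = 0 \<Longrightarrow> F w \<le> F zs"
    "(\<lambda>n. k n * N (z n)) \<longlonglongrightarrow> 0"
proof -
  have "\<exists>z\<in>Z. \<forall>w\<in>Z. F w - real (Suc n) * N w \<le> F z - real (Suc n) * N z" for n
    by (rule continuous_attains_sup) (use Z z0 in \<open>auto intro!: continuous_intros F N\<close>)
  then obtain y where y: "\<And>n. y n \<in> Z"
    "\<And>n w. w \<in> Z \<Longrightarrow> F w - real (Suc n) * N w \<le> F (y n) - real (Suc n) * N (y n)"
    by metis
  obtain zs r where r: "zs \<in> Z" "strict_mono r" "(y \<circ> r) \<longlonglongrightarrow> zs"
    using Z[unfolded compact_def, rule_format, of y] y(1) by auto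
  define z where "z n = y (r n)" for n
  define k where "k n = real (Suc (r n))" for n
  have zZ: "z n \<in> Z" for n using y(1) z_def by simp
  have kpos: "0 < k n" for n by (simp add: k_def)
  have kn: "real n \<le> k n" for n
    using seq_suble[OF r(2), of n] by (simp add: k_def)
  have max: "F w - k n * N w \<le> F (z n) - k n * N (z n)" if "w \<in> Z" for n w
    using y(2)[OF that] by (simp add: k_def z_def)
  have lim: "z \<longlonglongrightarrow> zs" using r(3) by (simp add: z_def[abs_def] comp_def)
  have limF: "(\<lambda>n. F (z n)) \<longlonglongrightarrow> F zs"
    by (rule continuous_on_tendsto_compose[OF F lim r(1)]) (simp add: zZ)
  have limN: "(\<lambda>n. N (z n)) \<longlonglongrightarrow> N zs"
    by (rule continuous_on_tendsto_compose[OF N lim r(1)]) (simp add: zZ)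
  have Nzs: "N zs = 0"
  proof (rule LIMSEQ_unique[OF limN], rule tendsto_sandwich[OF _ _ tendsto_const])
    show "\<forall>\<^sub>F n in sequentially. 0 \<le> N (z n)" by (simp add: N0 zZ)
    show "\<forall>\<^sub>F n in sequentially. N (z n) \<le> (F (z n) - F z0) * inverse (real n)"
      using eventually_gt_at_top[of 0]
    proof eventually_elim
      case (elim n)
      have "real n * N (z n) \<le> k n * N (z n)" by (intro mult_right_mono kn N0 zZ)
      also have "\<dots> \<le> F (z n) - F z0" using max[OF z0(1), of n] z0(2) by simp
      finally show ?case using elim by (simp add: field_simps)
    qed
    have "(\<lambda>n. (F (z n) - F z0) * inverse (real n)) \<longlonglongrightarrow> (F zs - F z0) * 0"
      by (intro tendsto_intros limF lim_inverse_n)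
    then show "(\<lambda>n. (F (z n) - F z0) * inverse (real n)) \<longlonglongrightarrow> 0" by simp
  qed
  show ?thesis
  proof (rule that[of k z zs])
    show "(\<lambda>n. k n * N (z n)) \<longlonglongrightarrow> 0"
    proof (rule tendsto_sandwich[OF _ _ tendsto_const])
      show "\<forall>\<^sub>F n in sequentially. 0 \<le> k n * N (z n)"
        by (intro always_eventually allI mult_nonneg_nonneg N0 zZ less_imp_le[OF kpos])
      show "\<forall>\<^sub>F n in sequentially. k n * N (z n) \<le> F (z n) - F zs"
        using max[OF r(1)] Nzs by (simp add: algebra_simps)
      show "(\<lambda>n. F (z n) - F zs) \<longlonglongrightarrow> 0"
        using tendsto_diff[OF limF tendsto_const[of "F zs"]] by simp
    qed
    show "F w \<le> F zs" if "w \<in> Z" "N w = 0" for w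
    proof (rule LIMSEQ_le_const[OF limF], intro exI[of _ 0] allI impI)
      fix n
      have "F w \<le> F (z n) - k n * N (z n)" using max[OF that(1), of n] that(2) by simp
      moreover have "0 \<le> k n * N (z n)" using kpos[of n] N0[of "z n"] by simp
      ultimately show "F w \<le> F (z n)" by simp
    qed
  qed (use kpos zZ max lim r(1) Nzs in auto)
qed

lemma C1_test_quadratic:
  "C1_test (\<lambda>z. k / 2 * ((z - w) \<bullet> (z - w))) (\<lambda>z. k *\<^sub>R (z - w))"
  unfolding C1_test_def gderiv_def
  by (auto intro!: derivative_eq_intros continuous_intros simp: fun_eq_iff inner_commute algebra_simps)

lemma visc_subsolution_quadratic:
  assumes "visc_subsolution H G" "0 < snd z"
    and "\<forall>\<^sub>F v in nhds z. G v - k / 2 * ((v - w) \<bullet> (v - w)) \<le> G z - k / 2 * ((z - w) \<bullet> (z - w))"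
  shows "k * (snd z - snd w) + H (fst z) (k *\<^sub>R (fst z - fst w)) \<le> 0"
proof -
  have "snd (k *\<^sub>R (z - w)) + H (fst z) (fst (k *\<^sub>R (z - w))) \<le> 0"
    using assms(1)[unfolded visc_subsolution_def, THEN conjunct2, rule_format,
        OF C1_test_quadratic[of k w], of "snd z" "fst z"] assms(2,3) by simp
  then show ?thesis by simp
qed

lemma visc_supersolution_quadratic:
  assumes "visc_supersolution H G" "0 < snd z"
    and "\<forall>\<^sub>F v in nhds z. G v + k / 2 * ((v - w) \<bullet> (v - w)) \<ge> G z + k / 2 * ((z - w) \<bullet> (z - w))"
  shows "0 \<le> k * (snd w - snd z) + H (fst z) (k *\<^sub>R (fst w - fst z))"
proof -
  have "\<forall>\<^sub>F v in nhds z. G v - (-k) / 2 * ((v - w) \<bullet> (v - w)) \<ge> G z - (-k) / 2 * ((z - w) \<bullet> (z - w))"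
    using assms(3) by simp
  then have "0 \<le> snd ((-k) *\<^sub>R (z - w)) + H (fst z) (fst ((-k) *\<^sub>R (z - w)))"
    using assms(1)[unfolded visc_supersolution_def, THEN conjunct2, rule_format,
        OF C1_test_quadratic[of "-k" w], of "snd z" "fst z"] assms(2) by simp
  moreover have "(-k) *\<^sub>R (z - w) = k *\<^sub>R (w - z)" by (simp add: algebra_simps)
  ultimately show ?thesis by (simp only:) simp
qed

text \<open>The doubling arguments below maximise over an additional parameter \<open>\<sigma>\<close> ranging over a compact
  interval, to which the time variables of the solutions are tied by the penalty. Only \<open>\<sigma>\<close> is
  restricted at the terminal time, where this one-sided first-order condition is enough; the time
  variables of the solutions stay interior, so that the viscosity inequalities apply.\<close>

lemma left_max_derivative_nonneg:
  fixes f :: "real \<Rightarrow> real"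
  assumes "(f has_real_derivative D) (at s within {a..b})" "a < s" "s \<le> b"
    and "\<And>r. r \<in> {a..b} \<Longrightarrow> f r \<le> f s"
  shows "0 \<le> D"
proof (rule ccontr)
  assume "\<not> 0 \<le> D"
  then obtain e where e: "e > 0" "\<And>h. 0 < h \<Longrightarrow> s - h \<in> {a..b} \<Longrightarrow> h < e \<Longrightarrow> f s < f (s - h)"
    using has_real_derivative_neg_dec_left[OF assms(1)] by force
  define h where "h = min (e / 2) (s - a)"
  have "0 < h" "h < e" "s - h \<in> {a..b}" using e(1) assms(2,3) by (auto simp: h_def)
  then show False using e(2)[of h] assms(4)[of "s - h"] by force
qed

section \<open>Barriers for supersolutions\<close>

text \<open>A convex compact set whose inward normals \<open>q\<close> satisfy \<open>H x q \<le> 0\<close> is a barrier for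
  supersolutions: a lower bound on it persists. The proof minimises the supersolution plus the
  penalised squared distance to the set, so that the covector tested is normal to the set at the
  closest point.\<close>

lemma supersolution_barrier:
  fixes H :: "real^2 \<Rightarrow> real^2 \<Rightarrow> real" and D :: "(real^2) set"
  assumes super: "visc_supersolution H G" and cont: "continuous_on (UNIV \<times> {0..}) G"
    and lip: "\<And>x y q. H x q \<le> H y q + L * norm (x - y) * norm q" and L: "0 \<le> L"
    and D: "compact D" "convex D"
    and cone: "\<And>x q. x \<in> D \<Longrightarrow> (\<And>y. y \<in> D \<Longrightarrow> 0 \<le> q \<bullet> (y - x)) \<Longrightarrow> H x q \<le> 0"
    and init: "\<And>x. x \<in> D \<Longrightarrow> c \<le> G (x, 0)"
    and x: "x \<in> D" and t: "0 \<le> t"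
  shows "c \<le> G (x, t)"
proof -
  obtain R where R: "D \<subseteq> ball 0 R"
    using compact_imp_bounded[OF D(1)] bounded_subset_ballD by blast
  define Z where "Z = (cball (0::real^2) R \<times> {0..t+1}) \<times> (D \<times> {0..t})"
  define N :: "((real^2) \<times> real) \<times> ((real^2) \<times> real) \<Rightarrow> real"
    where "N = (\<lambda>p. (fst p - snd p) \<bullet> (fst p - snd p) / 2)"
  have main: "c - \<delta> * t \<le> G (x, t)" if \<delta>: "0 < \<delta>" for \<delta>
  proof -
    define F where "F = (\<lambda>p :: ((real^2) \<times> real) \<times> ((real^2) \<times> real). - G (fst p) - \<delta> * snd (snd p))"
    have xt: "((x, t), (x, t)) \<in> Z" "N ((x, t), (x, t)) = 0"
      using R x t by (auto simp: Z_def N_def)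
    have Z: "compact Z" unfolding Z_def by (intro compact_Times compact_cball compact_Icc D)
    have F: "continuous_on Z F"
      unfolding F_def by (intro continuous_intros continuous_on_compose2[OF cont]) (auto simp: Z_def)
    have N: "continuous_on Z N" unfolding N_def by (intro continuous_intros) auto
    have N0: "0 \<le> N z" for z by (simp add: N_def)
    obtain k z zs where k: "\<And>n. 0 < k n" and z: "\<And>n. z n \<in> Z"
      and max: "\<And>n w. w \<in> Z \<Longrightarrow> F w - k n * N w \<le> F (z n) - k n * N (z n)"
      and lim: "z \<longlonglongrightarrow> zs" and zs: "zs \<in> Z" "N zs = 0"
      and maxs: "\<And>w. w \<in> Z \<Longrightarrow> N w = 0 \<Longrightarrow> F w \<le> F zs"
      and kN: "(\<lambda>n. k n * N (z n)) \<longlonglongrightarrow> 0"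
      by (rule penalization[OF Z F N N0 xt]) (rule that)
    have zs_eq: "fst zs = snd zs" using zs(2) by (simp add: N_def)
    define xs ss where "xs = fst (snd zs)" and "ss = snd (snd zs)"
    have zs': "zs = ((xs, ss), (xs, ss))" using zs_eq by (simp add: xs_def ss_def prod_eq_iff)
    have xs: "xs \<in> D" "0 \<le> ss" "ss \<le> t" using zs(1) by (auto simp: zs' Z_def)
    have "ss = 0"
    proof (rule ccontr)
      assume "ss \<noteq> 0"
      then have ss: "0 < ss" using xs by simp
      define U where "U = ball (0::real^2) R \<times> {0<..<t+1}"
      have U: "open U" unfolding U_def by (intro open_Times) auto
      have "eventually (\<lambda>n. fst (z n) \<in> U) sequentially"
        by (rule topological_tendstoD[OF tendsto_fst[OF lim] U]) (use xs ss R in \<open>auto simp: zs' U_def\<close>)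
      moreover have "eventually (\<lambda>n. snd (snd (z n)) \<in> {0<..}) sequentially"
        by (rule topological_tendstoD[OF tendsto_snd[OF tendsto_snd[OF lim]]]) (use ss in \<open>auto simp: zs'\<close>)
      moreover have "eventually (\<lambda>n. 2 * L * (k n * N (z n)) < \<delta>) sequentially"
        by (rule order_tendstoD(2)[OF tendsto_mult_left[OF kN, of "2 * L"]]) (use \<delta> in simp)
      ultimately have "\<forall>\<^sub>F n in sequentially. fst (z n) \<in> U \<and> 0 < snd (snd (z n)) \<and>
          2 * L * (k n * N (z n)) < \<delta>"
        by eventually_elim simp
      from eventually_happens'[OF sequentially_bot this]
      obtain n where n: "fst (z n) \<in> U" "0 < snd (snd (z n))"
          "2 * L * (k n * N (z n)) < \<delta>"
        by blast
      obtain y s \<xi> \<sigma> where zn: "z n = ((y, s), (\<xi>, \<sigma>))" by (metis prod.collapse)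
      have in_Z: "\<xi> \<in> D" "0 < \<sigma>" "\<sigma> \<le> t" "(y, s) \<in> U" "0 < s"
        using z[of n] n by (auto simp: zn Z_def U_def)
      define q where "q = k n *\<^sub>R (\<xi> - y)"
      have "\<forall>\<^sub>F v in nhds (y, s). v \<in> U"
        by (rule eventually_nhds_in_open[OF U in_Z(4)])
      then have "\<forall>\<^sub>F v in nhds (y, s). G v + k n / 2 * ((v - (\<xi>, \<sigma>)) \<bullet> (v - (\<xi>, \<sigma>)))
          \<ge> G (y, s) + k n / 2 * (((y, s) - (\<xi>, \<sigma>)) \<bullet> ((y, s) - (\<xi>, \<sigma>)))"
      proof (rule eventually_mono)
        fix v assume v: "v \<in> U"
        have "(v, (\<xi>, \<sigma>)) \<in> Z" using v in_Z by (auto simp: Z_def U_def)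
        from max[OF this, of n]
        show "G v + k n / 2 * ((v - (\<xi>, \<sigma>)) \<bullet> (v - (\<xi>, \<sigma>)))
          \<ge> G (y, s) + k n / 2 * (((y, s) - (\<xi>, \<sigma>)) \<bullet> ((y, s) - (\<xi>, \<sigma>)))"
          by (simp add: zn F_def N_def)
      qed
      from visc_supersolution_quadratic[OF super _ this] in_Z
      have visc: "0 \<le> k n * (\<sigma> - s) + H y q" by (simp add: q_def)
      have closest: "\<forall>\<eta>\<in>D. dist y \<xi> \<le> dist y \<eta>"
      proof
        fix \<eta> assume "\<eta> \<in> D"
        then have "((y, s), (\<eta>, \<sigma>)) \<in> Z" using in_Z by (auto simp: Z_def U_def)
        from max[OF this, of n] have "k n * ((y - \<xi>) \<bullet> (y - \<xi>)) \<le> k n * ((y - \<eta>) \<bullet> (y - \<eta>))"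
          by (simp add: zn F_def N_def distrib_left add_divide_distrib)
        then have "(y - \<xi>) \<bullet> (y - \<xi>) \<le> (y - \<eta>) \<bullet> (y - \<eta>)" using k[of n] by simp
        then show "dist y \<xi> \<le> dist y \<eta>" by (simp add: dist_norm norm_le)
      qed
      have "H \<xi> q \<le> 0"
      proof (rule cone[OF in_Z(1)])
        fix \<eta> assume "\<eta> \<in> D"
        from any_closest_point_dot[OF D(2) compact_imp_closed[OF D(1)] in_Z(1) this closest]
        have "0 \<le> k n * ((\<xi> - y) \<bullet> (\<eta> - \<xi>))"
          using k[of n] by (intro mult_nonneg_nonneg) (auto simp: algebra_simps)
        then show "0 \<le> q \<bullet> (\<eta> - \<xi>)" by (simp add: q_def)
      qed
      moreover have "norm (y - \<xi>) * norm q = k n * ((y - \<xi>) \<bullet> (y - \<xi>))"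
        using k[of n] by (simp add: q_def norm_minus_commute power2_norm_eq_inner[symmetric] power2_eq_square)
      moreover have "k n * ((y - \<xi>) \<bullet> (y - \<xi>)) \<le> 2 * (k n * N (z n))"
        using k[of n] by (simp add: N_def zn distrib_left)
      ultimately have H_le: "H y q \<le> L * (2 * (k n * N (z n)))"
        using lip[of y q \<xi>] L mult_left_mono[OF _ L] by (smt (verit) mult.assoc)
      have der: "((\<lambda>r. - \<delta> * r - k n / 2 * (s - r)\<^sup>2) has_real_derivative - \<delta> + k n * (s - \<sigma>)) (at \<sigma> within {0..t})"
        by (auto intro!: derivative_eq_intros simp: field_simps)
      have "0 \<le> - \<delta> + k n * (s - \<sigma>)"
      proof (rule left_max_derivative_nonneg[OF der])
        fix r assume "r \<in> {0..t}"
        then have "((y, s), (\<xi>, r)) \<in> Z" using in_Z by (auto simp: Z_def U_def)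
        from max[OF this, of n]
        show "- \<delta> * r - k n / 2 * (s - r)\<^sup>2 \<le> - \<delta> * \<sigma> - k n / 2 * (s - \<sigma>)\<^sup>2"
          by (simp add: zn F_def N_def distrib_left add_divide_distrib power2_eq_square)
      qed (use in_Z in auto)
      then have "\<delta> \<le> 2 * L * (k n * N (z n))"
        using visc H_le by (simp add: algebra_simps)
      then show False using n(3) by simp
    qed
    then have "F zs \<le> - c" using init[OF xs(1)] by (simp add: F_def zs')
    then show ?thesis using maxs[OF xt] by (simp add: F_def)
  qed
  show ?thesis
  proof (rule field_le_epsilon)
    fix e :: real assume e: "0 < e"
    have "c - e / (t + 1) * t \<le> G (x, t)" by (rule main) (use e t in simp)
    moreover have "e / (t + 1) * t \<le> e" using e t by (simp add: field_simps)
    ultimately show "c \<le> G (x, t) + e" by simp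
  qed
qed

section \<open>Transport of subsolutions along admissible curves\<close>

text \<open>Subsolutions do not increase along space-time curves \<open>(\<gamma>, \<tau>)\<close> that are admissible in the sense
  that \<open>\<gamma>' \<bullet> q \<le> \<tau>' H(\<gamma>, q)\<close> for all \<open>q\<close>. The curve is parametrised freely; \<open>\<rho> = \<tau>'\<close> is the time spent
  per unit of the parameter.\<close>

lemma transport_positive_times:
  fixes H :: "real^2 \<Rightarrow> real^2 \<Rightarrow> real" and \<gamma> \<gamma>' :: "real \<Rightarrow> real^2" and \<tau> \<rho> :: "real \<Rightarrow> real"
  assumes sub: "visc_subsolution H G" and cont: "continuous_on (UNIV \<times> {0..}) G"
    and lip: "\<And>x y q. H x q \<le> H y q + L * norm (x - y) * norm q" and L: "0 \<le> L"
    and ab: "a \<le> b"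
    and \<gamma>: "\<And>\<sigma>. \<sigma> \<in> {a..b} \<Longrightarrow> (\<gamma> has_vector_derivative \<gamma>' \<sigma>) (at \<sigma> within {a..b})"
    and \<tau>: "\<And>\<sigma>. \<sigma> \<in> {a..b} \<Longrightarrow> (\<tau> has_real_derivative \<rho> \<sigma>) (at \<sigma> within {a..b})"
    and \<rho>: "\<And>\<sigma>. \<sigma> \<in> {a..b} \<Longrightarrow> 0 \<le> \<rho> \<sigma>" "\<And>\<sigma>. \<sigma> \<in> {a..b} \<Longrightarrow> \<rho> \<sigma> \<le> B"
    and adm: "\<And>\<sigma> q. \<sigma> \<in> {a..b} \<Longrightarrow> \<gamma>' \<sigma> \<bullet> q \<le> \<rho> \<sigma> * H (\<gamma> \<sigma>) q"
    and pos: "\<And>\<sigma>. \<sigma> \<in> {a..b} \<Longrightarrow> 0 < \<tau> \<sigma>"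
  shows "G (\<gamma> b, \<tau> b) \<le> G (\<gamma> a, \<tau> a)"
proof -
  have c\<gamma>: "continuous_on {a..b} \<gamma>"
    using \<gamma> has_vector_derivative_continuous continuous_on_eq_continuous_within by blast
  have c\<tau>: "continuous_on {a..b} \<tau>"
    using \<tau> DERIV_continuous continuous_on_eq_continuous_within by blast
  define \<Gamma> where "\<Gamma> = (\<lambda>\<sigma>. (\<gamma> \<sigma>, \<tau> \<sigma>))"
  have c\<Gamma>: "continuous_on {a..b} \<Gamma>" unfolding \<Gamma>_def by (intro continuous_intros c\<gamma> c\<tau>)
  have "bounded (\<Gamma> ` {a..b})"
    by (intro compact_imp_bounded compact_continuous_image c\<Gamma> compact_Icc)
  then obtain R where R: "\<Gamma> ` {a..b} \<subseteq> ball 0 R" using bounded_subset_ballD by blast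
  define Z where "Z = (cball (0 :: (real^2) \<times> real) R \<inter> UNIV \<times> {0..}) \<times> {a..b}"
  define N :: "((real^2) \<times> real) \<times> real \<Rightarrow> real"
    where "N = (\<lambda>p. (fst p - \<Gamma> (snd p)) \<bullet> (fst p - \<Gamma> (snd p)) / 2)"
  have \<Gamma>_in: "(\<Gamma> \<sigma>, \<sigma>) \<in> Z" "N (\<Gamma> \<sigma>, \<sigma>) = 0" if "\<sigma> \<in> {a..b}" for \<sigma>
    using R that pos[OF that] by (auto simp: Z_def N_def \<Gamma>_def image_subset_iff less_imp_le)
  have main: "G (\<Gamma> b) - \<delta> * (b - a) \<le> G (\<Gamma> a)" if \<delta>: "0 < \<delta>" for \<delta>
  proof -
    define F where "F = (\<lambda>p :: ((real^2) \<times> real) \<times> real. G (fst p) - \<delta> * snd p)"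
    have Z: "compact Z" unfolding Z_def
      by (intro compact_Times compact_Int_closed closed_Times) auto
    have F: "continuous_on Z F"
      unfolding F_def by (intro continuous_intros continuous_on_compose2[OF cont]) (auto simp: Z_def)
    have N: "continuous_on Z N" unfolding N_def
      by (intro continuous_intros continuous_on_compose2[OF c\<Gamma>]) (auto simp: Z_def)
    have N0: "0 \<le> N z" for z by (simp add: N_def)
    have bZ: "(\<Gamma> b, b) \<in> Z" "N (\<Gamma> b, b) = 0" using \<Gamma>_in ab by auto
    obtain k z zs where k: "\<And>n. 0 < k n" and z: "\<And>n. z n \<in> Z"
      and max: "\<And>n w. w \<in> Z \<Longrightarrow> F w - k n * N w \<le> F (z n) - k n * N (z n)"
      and lim: "z \<longlonglongrightarrow> zs" and zs: "zs \<in> Z" "N zs = 0"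
      and maxs: "\<And>w. w \<in> Z \<Longrightarrow> N w = 0 \<Longrightarrow> F w \<le> F zs"
      and kN: "(\<lambda>n. k n * N (z n)) \<longlonglongrightarrow> 0"
      by (rule penalization[OF Z F N N0 bZ]) (rule that)
    define ss where "ss = snd zs"
    have zs': "zs = (\<Gamma> ss, ss)" using zs(2) by (simp add: N_def ss_def prod_eq_iff)
    have ss: "ss \<in> {a..b}" using zs(1) by (auto simp: zs' Z_def)
    have "ss = a"
    proof (rule ccontr)
      assume "ss \<noteq> a"
      define U where "U = ball (0 :: (real^2) \<times> real) R \<inter> UNIV \<times> {0<..}"
      have U: "open U" unfolding U_def by (intro open_Int open_Times) auto
      have "eventually (\<lambda>n. fst (z n) \<in> U) sequentially"
        by (rule topological_tendstoD[OF tendsto_fst[OF lim] U])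
          (use R ss pos[OF ss] in \<open>auto simp: zs' U_def \<Gamma>_def image_subset_iff\<close>)
      moreover have "eventually (\<lambda>n. snd (z n) \<in> {a<..}) sequentially"
        by (rule topological_tendstoD[OF tendsto_snd[OF lim]]) (use ss \<open>ss \<noteq> a\<close> in \<open>auto simp: zs'\<close>)
      moreover have "eventually (\<lambda>n. 2 * L * B * (k n * N (z n)) < \<delta>) sequentially"
        by (rule order_tendstoD(2)[OF tendsto_mult_left[OF kN, of "2 * L * B"]]) (use \<delta> in simp)
      ultimately have "\<forall>\<^sub>F n in sequentially. fst (z n) \<in> U \<and> a < snd (z n) \<and>
          2 * L * B * (k n * N (z n)) < \<delta>"
        by eventually_elim simp
      from eventually_happens'[OF sequentially_bot this]
      obtain n where n: "fst (z n) \<in> U" "a < snd (z n)" "2 * L * B * (k n * N (z n)) < \<delta>"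
        by blast
      obtain y s \<sigma> where zn: "z n = ((y, s), \<sigma>)" by (metis prod.collapse)
      have in_Z: "\<sigma> \<in> {a..b}" "a < \<sigma>" "\<sigma> \<le> b" "(y, s) \<in> U" "0 < s"
        using z[of n] n by (auto simp: zn Z_def U_def)
      define q where "q = k n *\<^sub>R (y - \<gamma> \<sigma>)"
      define h where "h = k n * N (z n)"
      have h0: "0 \<le> h" using k[of n] N0[of "z n"] by (simp add: h_def)
      have "\<forall>\<^sub>F v in nhds (y, s). v \<in> U"
        by (rule eventually_nhds_in_open) (use in_Z U in auto)
      then have "\<forall>\<^sub>F v in nhds (y, s). G v - k n / 2 * ((v - \<Gamma> \<sigma>) \<bullet> (v - \<Gamma> \<sigma>))
          \<le> G (y, s) - k n / 2 * (((y, s) - \<Gamma> \<sigma>) \<bullet> ((y, s) - \<Gamma> \<sigma>))"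
      proof (rule eventually_mono)
        fix v assume v: "v \<in> U"
        have "(v, \<sigma>) \<in> Z" using v in_Z by (cases v) (auto simp: Z_def U_def)
        from max[OF this, of n]
        show "G v - k n / 2 * ((v - \<Gamma> \<sigma>) \<bullet> (v - \<Gamma> \<sigma>))
          \<le> G (y, s) - k n / 2 * (((y, s) - \<Gamma> \<sigma>) \<bullet> ((y, s) - \<Gamma> \<sigma>))"
          by (simp add: zn F_def N_def)
      qed
      from visc_subsolution_quadratic[OF sub _ this] in_Z
      have visc: "k n * (s - \<tau> \<sigma>) + H y q \<le> 0" by (simp add: q_def \<Gamma>_def)
      have nq: "norm (\<gamma> \<sigma> - y) * norm q = k n * ((y - \<gamma> \<sigma>) \<bullet> (y - \<gamma> \<sigma>))"
        using k[of n] by (simp add: q_def norm_minus_commute power2_norm_eq_inner[symmetric] power2_eq_square)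
      have "k n * ((y - \<gamma> \<sigma>) \<bullet> (y - \<gamma> \<sigma>)) \<le> 2 * h"
        using k[of n] by (simp add: h_def N_def zn \<Gamma>_def distrib_left)
      then have "L * norm (\<gamma> \<sigma> - y) * norm q \<le> L * (2 * h)"
        unfolding mult.assoc nq by (intro mult_left_mono L)
      then have H_le: "H (\<gamma> \<sigma>) q \<le> - (k n * (s - \<tau> \<sigma>)) + L * (2 * h)"
        using lip[of "\<gamma> \<sigma>" q y] visc by linarith
      have der\<gamma>: "(\<gamma> has_derivative (\<lambda>r. r *\<^sub>R \<gamma>' \<sigma>)) (at \<sigma> within {a..b})"
        using \<gamma>[OF in_Z(1)] by (simp add: has_vector_derivative_def)
      have der\<tau>: "(\<tau> has_derivative (\<lambda>r. r * \<rho> \<sigma>)) (at \<sigma> within {a..b})"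
        using \<tau>[OF in_Z(1)] by (simp add: has_field_derivative_def mult_commute_abs)
      have der: "((\<lambda>r. - \<delta> * r - k n / 2 * ((y - \<gamma> r) \<bullet> (y - \<gamma> r) + (s - \<tau> r) * (s - \<tau> r)))
          has_real_derivative - \<delta> + (q \<bullet> \<gamma>' \<sigma> + k n * (s - \<tau> \<sigma>) * \<rho> \<sigma>)) (at \<sigma> within {a..b})"
        unfolding has_field_derivative_def
        by (rule derivative_eq_intros der\<gamma> der\<tau> refl)+
          (simp add: fun_eq_iff q_def inner_commute algebra_simps)
      have "0 \<le> - \<delta> + (q \<bullet> \<gamma>' \<sigma> + k n * (s - \<tau> \<sigma>) * \<rho> \<sigma>)"
      proof (rule left_max_derivative_nonneg[OF der])
        fix r assume "r \<in> {a..b}"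
        then have "((y, s), r) \<in> Z" using z[of n] by (auto simp: Z_def zn)
        from max[OF this, of n]
        show "- \<delta> * r - k n / 2 * ((y - \<gamma> r) \<bullet> (y - \<gamma> r) + (s - \<tau> r) * (s - \<tau> r))
          \<le> - \<delta> * \<sigma> - k n / 2 * ((y - \<gamma> \<sigma>) \<bullet> (y - \<gamma> \<sigma>) + (s - \<tau> \<sigma>) * (s - \<tau> \<sigma>))"
          by (simp add: zn F_def N_def \<Gamma>_def)
      qed (use in_Z in auto)
      moreover have "q \<bullet> \<gamma>' \<sigma> \<le> \<rho> \<sigma> * (- (k n * (s - \<tau> \<sigma>)) + L * (2 * h))"
        using adm[OF in_Z(1), of q] mult_left_mono[OF H_le \<rho>(1)[OF in_Z(1)]] by (simp add: inner_commute)
      ultimately have "\<delta> \<le> \<rho> \<sigma> * (L * (2 * h))" by (simp add: algebra_simps)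
      also have "\<dots> \<le> B * (L * (2 * h))"
        using \<rho>(2)[OF in_Z(1)] L h0 by (intro mult_right_mono) auto
      finally show False using n(3) by (simp add: h_def mult_ac)
    qed
    then show ?thesis using maxs[OF bZ] by (simp add: F_def zs' algebra_simps)
  qed
  have "G (\<Gamma> b) \<le> G (\<Gamma> a)"
  proof (rule field_le_epsilon)
    fix e :: real assume e: "0 < e"
    have "G (\<Gamma> b) - e / (b - a + 1) * (b - a) \<le> G (\<Gamma> a)" by (rule main) (use e ab in simp)
    moreover have "e / (b - a + 1) * (b - a) \<le> e" using e ab by (simp add: field_simps)
    ultimately show "G (\<Gamma> b) \<le> G (\<Gamma> a) + e" by simp
  qed
  then show ?thesis by (simp add: \<Gamma>_def)
qed

text \<open>\<open>reaches G x y B\<close>: after some fixed delay of at most \<open>B\<close>, the values of \<open>G\<close> at \<open>y\<close> are at most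
  those at \<open>x\<close>. The delay may depend on \<open>G\<close>, but not on the time.\<close>

definition reaches :: "((real^2) \<times> real \<Rightarrow> real) \<Rightarrow> real^2 \<Rightarrow> real^2 \<Rightarrow> real \<Rightarrow> bool" where
  "reaches G x y B \<longleftrightarrow> (\<exists>T. 0 \<le> T \<and> T \<le> B \<and> (\<forall>t\<ge>0. G (y, t + T) \<le> G (x, t)))"

lemma reaches_trans:
  assumes "reaches G x y B" "reaches G y z C"
  shows "reaches G x z (B + C)"
proof -
  obtain T S where T: "0 \<le> T" "T \<le> B" "\<And>t. 0 \<le> t \<Longrightarrow> G (y, t + T) \<le> G (x, t)"
    and S: "0 \<le> S" "S \<le> C" "\<And>t. 0 \<le> t \<Longrightarrow> G (z, t + S) \<le> G (y, t)"
    using assms unfolding reaches_def by blast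
  have "G (z, t + (T + S)) \<le> G (x, t)" if "0 \<le> t" for t
    using S(3)[of "t + T"] T(3)[OF that] T(1) that by (simp add: add.assoc)
  then show ?thesis unfolding reaches_def using S T by (intro exI[of _ "T + S"]) auto
qed

text \<open>The time function is recovered as the integral of \<open>\<rho>\<close>. Starting at time zero is a limit of
  starting at positive times.\<close>

lemma transport:
  fixes H :: "real^2 \<Rightarrow> real^2 \<Rightarrow> real" and \<gamma> \<gamma>' :: "real \<Rightarrow> real^2" and \<rho> :: "real \<Rightarrow> real"
  assumes sub: "visc_subsolution H G" and cont: "continuous_on (UNIV \<times> {0..}) G"
    and lip: "\<And>x y q. H x q \<le> H y q + L * norm (x - y) * norm q" and L: "0 \<le> L"
    and ab: "a \<le> b"
    and \<gamma>: "\<And>\<sigma>. \<sigma> \<in> {a..b} \<Longrightarrow> (\<gamma> has_vector_derivative \<gamma>' \<sigma>) (at \<sigma> within {a..b})"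
    and c\<rho>: "continuous_on {a..b} \<rho>"
    and \<rho>: "\<And>\<sigma>. \<sigma> \<in> {a..b} \<Longrightarrow> 0 \<le> \<rho> \<sigma>" "\<And>\<sigma>. \<sigma> \<in> {a..b} \<Longrightarrow> \<rho> \<sigma> \<le> B"
    and adm: "\<And>\<sigma> q. \<sigma> \<in> {a..b} \<Longrightarrow> \<gamma>' \<sigma> \<bullet> q \<le> \<rho> \<sigma> * H (\<gamma> \<sigma>) q"
  shows "reaches G (\<gamma> a) (\<gamma> b) (B * (b - a))"
proof -
  define I where "I = (\<lambda>\<sigma>. integral {a..\<sigma>} \<rho>)"
  have int: "\<rho> integrable_on {a..\<sigma>}" if "\<sigma> \<in> {a..b}" for \<sigma>
    using that by (intro integrable_continuous_real continuous_on_subset[OF c\<rho>]) auto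
  have I: "(I has_real_derivative \<rho> \<sigma>) (at \<sigma> within {a..b})" if "\<sigma> \<in> {a..b}" for \<sigma>
    using integral_has_real_derivative[OF c\<rho> that] by (simp add: I_def)
  have I0: "0 \<le> I \<sigma>" if "\<sigma> \<in> {a..b}" for \<sigma>
    unfolding I_def by (rule integral_nonneg[OF int[OF that]]) (use \<rho>(1) that in auto)
  have Ib: "I b \<le> B * (b - a)"
  proof -
    have "norm (I b) \<le> B * (b - a)"
      unfolding I_def by (rule integral_bound[OF ab c\<rho>]) (use \<rho> in auto)
    then show ?thesis by simp
  qed
  have Ia: "I a = 0" by (simp add: I_def)
  have pos: "G (\<gamma> b, t + I b) \<le> G (\<gamma> a, t)" if t: "0 < t" for t
  proof -
    have "G (\<gamma> b, t + I b) \<le> G (\<gamma> a, t + I a)"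
    proof (rule transport_positive_times[OF sub cont lip L ab \<gamma> _ \<rho> adm])
      fix \<sigma> assume "\<sigma> \<in> {a..b}"
      then show "((\<lambda>\<sigma>. t + I \<sigma>) has_real_derivative \<rho> \<sigma>) (at \<sigma> within {a..b})"
        by (auto intro!: derivative_eq_intros I)
    qed (use t I0 in \<open>auto simp: add_pos_nonneg\<close>)
    then show ?thesis by (simp add: Ia)
  qed
  have "G (\<gamma> b, t + I b) \<le> G (\<gamma> a, t)" if "0 \<le> t" for t
  proof (rule tendsto_le)
    show "((\<lambda>s. G (\<gamma> a, s)) \<longlongrightarrow> G (\<gamma> a, t)) (at t within {t<..})"
      by (rule continuous_on_tendsto_compose[OF cont])
        (use that in \<open>auto intro!: tendsto_intros simp: eventually_at_filter\<close>)
    show "((\<lambda>s. G (\<gamma> b, s + I b)) \<longlongrightarrow> G (\<gamma> b, t + I b)) (at t within {t<..})"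
      by (rule continuous_on_tendsto_compose[OF cont])
        (use that I0[of b] ab in \<open>auto intro!: tendsto_intros simp: eventually_at_filter\<close>)
    show "\<forall>\<^sub>F s in at t within {t<..}. G (\<gamma> b, s + I b) \<le> G (\<gamma> a, s)"
      using pos that by (auto simp: eventually_at_filter)
  qed (use trivial_limit_at_right_real[of t] in simp)
  then show ?thesis unfolding reaches_def using Ib I0[of b] ab by auto
qed

section \<open>Comparison in the planar periodic class\<close>

lemma translate_into_cell:
  fixes x :: "real^2"
  obtains k :: "int^2" where "x + (\<chi> i. 2 * pi * of_int (k$i)) \<in> cbox 0 (\<chi> i. 2 * pi)"
proof
  have "0 \<le> x $ i + 2 * pi * of_int (- \<lfloor>x $ i / (2 * pi)\<rfloor>) \<and>
        x $ i + 2 * pi * of_int (- \<lfloor>x $ i / (2 * pi)\<rfloor>) \<le> 2 * pi" for i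
  proof -
    have "x $ i = 2 * pi * (x $ i / (2 * pi))" by simp
    moreover have "2 * pi * of_int \<lfloor>x $ i / (2 * pi)\<rfloor> \<le> 2 * pi * (x $ i / (2 * pi))"
      by (intro mult_left_mono of_int_floor_le) simp
    moreover have "2 * pi * (x $ i / (2 * pi)) \<le> 2 * pi * (of_int \<lfloor>x $ i / (2 * pi)\<rfloor> + 1)"
      by (intro mult_left_mono real_of_int_floor_add_one_ge) simp
    ultimately show ?thesis by (simp add: algebra_simps)
  qed
  then show "x + (\<chi> i. 2 * pi * of_int ((\<chi> i. - \<lfloor>x $ i / (2 * pi)\<rfloor>) $ i)) \<in> cbox 0 (\<chi> i. 2 * pi)"
    by (simp add: mem_box_cart)
qed

text \<open>Joint periodicity of \<open>G\<^sub>1(x,t) - G\<^sub>2(y,s)\<close> in \<open>(x,y)\<close> is what planar solutions with the same slope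
  \<open>p\<close> share; it replaces compactness of the domain.\<close>

lemma comparison:
  fixes H :: "real^2 \<Rightarrow> real^2 \<Rightarrow> real"
  assumes sub: "visc_subsolution H G1" and super: "visc_supersolution H G2"
    and c1: "continuous_on (UNIV \<times> {0..}) G1" and c2: "continuous_on (UNIV \<times> {0..}) G2"
    and lip: "\<And>x y q. H x q \<le> H y q + L * norm (x - y) * norm q" and L: "0 \<le> L"
    and per: "\<And>x y t s (k :: int^2). 0 \<le> t \<Longrightarrow> 0 \<le> s \<Longrightarrow>
      G1 (x + (\<chi> i. 2 * pi * of_int (k$i)), t) - G2 (y + (\<chi> i. 2 * pi * of_int (k$i)), s)
        = G1 (x, t) - G2 (y, s)"
    and init: "\<And>x. G1 (x, 0) - G2 (x, 0) \<le> M"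
    and T: "0 \<le> T"
  shows "G1 (x0, T) - G2 (x0, T) \<le> M"
proof -
  define c :: "real^2" where "c = (\<chi> i. 2 * pi)"
  obtain R0 where R0: "cbox 0 c \<subseteq> ball 0 R0"
    using bounded_cbox bounded_subset_ballD by blast
  define R where "R = R0 + 1"
  define Z where "Z = (cbox 0 c \<times> {0..T+1}) \<times> ((cball (0::real^2) R \<times> {0..T+1}) \<times> {0..T})"
  define N :: "((real^2) \<times> real) \<times> (((real^2) \<times> real) \<times> real) \<Rightarrow> real"
    where "N = (\<lambda>p. ((fst (fst p) - fst (fst (snd p))) \<bullet> (fst (fst p) - fst (fst (snd p)))
      + (snd (fst p) - snd (snd p))\<^sup>2 + (snd (fst (snd p)) - snd (snd p))\<^sup>2) / 2)"
  have N_eq: "N ((x, t), (y, s), \<sigma>) = ((x - y) \<bullet> (x - y) + (t - \<sigma>)\<^sup>2 + (s - \<sigma>)\<^sup>2) / 2" for x t y s \<sigma>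
    by (simp add: N_def)
  have main: "G1 (x0, T) - G2 (x0, T) - \<delta> * T \<le> M" if \<delta>: "0 < \<delta>" for \<delta>
  proof -
    define F where "F = (\<lambda>p :: ((real^2) \<times> real) \<times> (((real^2) \<times> real) \<times> real).
      G1 (fst p) - G2 (fst (snd p)) - \<delta> * snd (snd p))"
    have Z: "compact Z" unfolding Z_def
      by (intro compact_Times compact_cball compact_Icc compact_cbox)
    have F: "continuous_on Z F" unfolding F_def
      by (intro continuous_intros continuous_on_compose2[OF c1] continuous_on_compose2[OF c2])
        (auto simp: Z_def)
    have N: "continuous_on Z N" unfolding N_def by (intro continuous_intros) auto
    have N0: "0 \<le> N z" for z by (simp add: N_def)
    \<comment> \<open>By periodicity the first point may leave the cell, as long as the second stays close to it.\<close>
    have move: "\<exists>w\<in>Z. F w = F ((x, t), (y, s), \<sigma>) \<and> N w = N ((x, t), (y, s), \<sigma>)"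
      if "norm (x - y) \<le> 1" "t \<in> {0..T+1}" "s \<in> {0..T+1}" "\<sigma> \<in> {0..T}" for x t y s \<sigma>
    proof -
      obtain k :: "int^2" where k: "x + (\<chi> i. 2 * pi * of_int (k$i)) \<in> cbox 0 c"
        unfolding c_def by (rule translate_into_cell)
      define e :: "real^2" where "e = (\<chi> i. 2 * pi * of_int (k$i))"
      have "norm (y + e) \<le> norm (x + e) + norm (x - y)"
        using norm_triangle_ineq4[of "x + e" "x - y"] by (simp add: add.commute)
      moreover have "norm (x + e) < R0" using k R0 by (auto simp: e_def)
      ultimately have "((x + e, t), (y + e, s), \<sigma>) \<in> Z"
        using k that by (auto simp: Z_def R_def e_def)
      moreover have "F ((x + e, t), (y + e, s), \<sigma>) = F ((x, t), (y, s), \<sigma>)"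
        using per[of t s x k y] that by (simp add: F_def e_def)
      moreover have "N ((x + e, t), (y + e, s), \<sigma>) = N ((x, t), (y, s), \<sigma>)" by (simp add: N_eq)
      ultimately show ?thesis by blast
    qed
    obtain w0 where w0: "w0 \<in> Z" "F w0 = F ((x0, T), (x0, T), T)" "N w0 = 0"
      using move[of x0 x0 T T T] T by (auto simp: N_eq)
    obtain k z zs where k: "\<And>n. 0 < k n" and z: "\<And>n. z n \<in> Z"
      and max0: "\<And>n w. w \<in> Z \<Longrightarrow> F w - k n * N w \<le> F (z n) - k n * N (z n)"
      and lim: "z \<longlonglongrightarrow> zs" and zs: "zs \<in> Z" "N zs = 0"
      and maxs: "\<And>w. w \<in> Z \<Longrightarrow> N w = 0 \<Longrightarrow> F w \<le> F zs"
      and kN: "(\<lambda>n. k n * N (z n)) \<longlonglongrightarrow> 0"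
      by (rule penalization[OF Z F N N0 w0(1,3)]) (rule that)
    have max: "F ((x, t), (y, s), \<sigma>) - k n * N ((x, t), (y, s), \<sigma>) \<le> F (z n) - k n * N (z n)"
      if "norm (x - y) \<le> 1" "t \<in> {0..T+1}" "s \<in> {0..T+1}" "\<sigma> \<in> {0..T}" for n x t y s \<sigma>
      using move[OF that] max0 by metis
    obtain xs ss where zs': "zs = ((xs, ss), (xs, ss), ss)"
    proof -
      obtain x t y s \<sigma> where zxt: "zs = ((x, t), (y, s), \<sigma>)" by (metis prod.collapse)
      have "a = 0 \<and> b = 0 \<and> c = 0" if "0 \<le> a" "0 \<le> b" "0 \<le> c" "(a + b + c) / 2 = 0" for a b c :: real
        using that by auto
      from this[OF _ _ _ zs(2)[unfolded zxt N_eq]]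
      have "(x - y) \<bullet> (x - y) = 0" "(t - \<sigma>)\<^sup>2 = 0" "(s - \<sigma>)\<^sup>2 = 0" by simp_all
      then show ?thesis using that zxt by simp
    qed
    have ss: "0 \<le> ss" "ss \<le> T" using zs(1) by (auto simp: zs' Z_def)
    have "ss = 0"
    proof (rule ccontr)
      assume "ss \<noteq> 0"
      then have "0 < ss" using ss by simp
      have "eventually (\<lambda>n. norm (fst (fst (z n)) - fst (fst (snd (z n)))) < 1 / 2) sequentially"
        by (rule order_tendstoD(2)[OF tendsto_norm[OF tendsto_diff[OF tendsto_fst[OF tendsto_fst[OF lim]]
           tendsto_fst[OF tendsto_fst[OF tendsto_snd[OF lim]]]]]]) (simp add: zs')
      moreover have "eventually (\<lambda>n. snd (fst (z n)) \<in> {0<..<T+1}) sequentially"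
        by (rule topological_tendstoD[OF tendsto_snd[OF tendsto_fst[OF lim]]])
          (use ss \<open>0 < ss\<close> in \<open>auto simp: zs'\<close>)
      moreover have "eventually (\<lambda>n. snd (fst (snd (z n))) \<in> {0<..<T+1}) sequentially"
        by (rule topological_tendstoD[OF tendsto_snd[OF tendsto_fst[OF tendsto_snd[OF lim]]]])
          (use ss \<open>0 < ss\<close> in \<open>auto simp: zs'\<close>)
      moreover have "eventually (\<lambda>n. snd (snd (z n)) \<in> {0<..}) sequentially"
        by (rule topological_tendstoD[OF tendsto_snd[OF tendsto_snd[OF lim]]])
          (use \<open>0 < ss\<close> in \<open>auto simp: zs'\<close>)
      moreover have "eventually (\<lambda>n. 2 * L * (k n * N (z n)) < \<delta>) sequentially"
        by (rule order_tendstoD(2)[OF tendsto_mult_left[OF kN, of "2 * L"]]) (use \<delta> in simp)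
      ultimately have "\<forall>\<^sub>F n in sequentially. norm (fst (fst (z n)) - fst (fst (snd (z n)))) < 1 / 2
          \<and> snd (fst (z n)) \<in> {0<..<T+1} \<and> snd (fst (snd (z n))) \<in> {0<..<T+1}
          \<and> 0 < snd (snd (z n)) \<and> 2 * L * (k n * N (z n)) < \<delta>"
        by eventually_elim simp
      from eventually_happens'[OF sequentially_bot this]
      obtain n where n: "norm (fst (fst (z n)) - fst (fst (snd (z n)))) < 1 / 2"
          "snd (fst (z n)) \<in> {0<..<T+1}" "snd (fst (snd (z n))) \<in> {0<..<T+1}"
          "0 < snd (snd (z n))" "2 * L * (k n * N (z n)) < \<delta>"
        by blast
      obtain x t y s \<sigma> where zn: "z n = ((x, t), (y, s), \<sigma>)" by (metis prod.collapse)
      have in_Z: "norm (x - y) < 1 / 2" "t \<in> {0<..<T+1}" "s \<in> {0<..<T+1}" "0 < \<sigma>" "\<sigma> \<le> T"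
        using z[of n] n by (auto simp: zn Z_def)
      define q where "q = k n *\<^sub>R (x - y)"
      define h where "h = k n * N (z n)"
      \<comment> \<open>Perturbations of either point by less than \<open>1/2\<close> keep the two points at distance at most \<open>1\<close>.\<close>
      have near: "\<forall>\<^sub>F v in nhds (a, r). norm (fst v - a) < 1 / 2 \<and> snd v \<in> {0<..<T+1}"
        if "r \<in> {0<..<T+1}" for a :: "real^2" and r
        using eventually_nhds_in_open[of "ball a (1/2) \<times> {0<..<T+1}" "(a, r)"] that
        by (auto simp: open_Times dist_norm norm_minus_commute elim: eventually_mono)
      have "\<forall>\<^sub>F v in nhds (x, t). G1 v - k n / 2 * ((v - (y, \<sigma>)) \<bullet> (v - (y, \<sigma>)))
          \<le> G1 (x, t) - k n / 2 * (((x, t) - (y, \<sigma>)) \<bullet> ((x, t) - (y, \<sigma>)))"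
        using near[OF in_Z(2), of x]
      proof (rule eventually_mono)
        fix v assume v: "norm (fst v - x) < 1 / 2 \<and> snd v \<in> {0<..<T+1}"
        then have "norm (fst v - y) \<le> 1"
          using in_Z(1) norm_triangle_ineq[of "fst v - x" "x - y"] by simp
        from max[OF this, of "snd v" s \<sigma> n]
        show "G1 v - k n / 2 * ((v - (y, \<sigma>)) \<bullet> (v - (y, \<sigma>)))
          \<le> G1 (x, t) - k n / 2 * (((x, t) - (y, \<sigma>)) \<bullet> ((x, t) - (y, \<sigma>)))"
          using v in_Z by (cases v) (simp add: zn F_def N_eq distrib_left add_divide_distrib power2_eq_square)
      qed
      from visc_subsolution_quadratic[OF sub _ this] in_Z
      have visc1: "k n * (t - \<sigma>) + H x q \<le> 0" by (simp add: q_def)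
      have swap: "(a - b) \<bullet> (a - b) = (b - a) \<bullet> (b - a)" for a b :: "real^2"
        by (simp add: algebra_simps)
      have "\<forall>\<^sub>F v in nhds (y, s). G2 v + k n / 2 * ((v - (x, \<sigma>)) \<bullet> (v - (x, \<sigma>)))
          \<ge> G2 (y, s) + k n / 2 * (((y, s) - (x, \<sigma>)) \<bullet> ((y, s) - (x, \<sigma>)))"
        using near[OF in_Z(3), of y]
      proof (rule eventually_mono)
        fix v assume v: "norm (fst v - y) < 1 / 2 \<and> snd v \<in> {0<..<T+1}"
        then have "norm (x - fst v) \<le> 1"
          using in_Z(1) norm_triangle_ineq4[of "x - y" "fst v - y"] by simp
        from max[OF this, of t "snd v" \<sigma> n]
        show "G2 v + k n / 2 * ((v - (x, \<sigma>)) \<bullet> (v - (x, \<sigma>)))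
          \<ge> G2 (y, s) + k n / 2 * (((y, s) - (x, \<sigma>)) \<bullet> ((y, s) - (x, \<sigma>)))"
          using v in_Z by (cases v) (simp add: zn F_def N_eq distrib_left add_divide_distrib power2_eq_square swap)
      qed
      from visc_supersolution_quadratic[OF super _ this] in_Z
      have visc2: "0 \<le> k n * (\<sigma> - s) + H y q" by (simp add: q_def)
      have nq: "norm (y - x) * norm q = k n * ((x - y) \<bullet> (x - y))"
        using k[of n] by (simp add: q_def norm_minus_commute power2_norm_eq_inner[symmetric] power2_eq_square)
      have "k n * ((x - y) \<bullet> (x - y)) \<le> 2 * h"
        using k[of n] by (simp add: h_def zn N_eq distrib_left)
      then have "L * norm (y - x) * norm q \<le> L * (2 * h)"
        unfolding mult.assoc nq by (intro mult_left_mono L)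
      then have H_le: "H y q \<le> H x q + L * (2 * h)"
        using lip[of y q x] by linarith
      have der: "((\<lambda>r. - \<delta> * r - k n / 2 * ((t - r)\<^sup>2 + (s - r)\<^sup>2)) has_real_derivative
          - \<delta> + k n * (t - \<sigma>) + k n * (s - \<sigma>)) (at \<sigma> within {0..T})"
        by (auto intro!: derivative_eq_intros simp: field_simps)
      have "0 \<le> - \<delta> + k n * (t - \<sigma>) + k n * (s - \<sigma>)"
      proof (rule left_max_derivative_nonneg[OF der])
        fix r assume "r \<in> {0..T}"
        then show "- \<delta> * r - k n / 2 * ((t - r)\<^sup>2 + (s - r)\<^sup>2) \<le> - \<delta> * \<sigma> - k n / 2 * ((t - \<sigma>)\<^sup>2 + (s - \<sigma>)\<^sup>2)"
          using max[of x y t s r n] in_Z by (simp add: zn F_def N_eq distrib_left add_divide_distrib)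
      qed (use in_Z in auto)
      then have "\<delta> \<le> L * (2 * h)"
        using visc1 visc2 H_le by (simp add: algebra_simps)
      then show False using n(5) by (simp add: h_def mult_ac)
    qed
    then have "F zs \<le> M" using init[of xs] by (simp add: F_def zs')
    then show ?thesis using maxs[OF w0(1,3)] w0(2) by (simp add: F_def)
  qed
  show ?thesis
  proof (rule field_le_epsilon)
    fix e :: real assume e: "0 < e"
    have "G1 (x0, T) - G2 (x0, T) - e / (T + 1) * T \<le> M" by (rule main) (use e T in simp)
    moreover have "e / (T + 1) * T \<le> e" using e T by (simp add: field_simps)
    ultimately show "G1 (x0, T) - G2 (x0, T) \<le> M + e" by simp
  qed
qed

section \<open>The Hamiltonian of the cellular flow\<close>

lemma cell_flow_nth:
  "cell_flow A x $ 1 = - (A * (sin (x$1) * cos (x$2)))"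
  "cell_flow A x $ 2 = A * (cos (x$1) * sin (x$2))"
  by (simp_all add: cell_flow_def)

lemma H_plus_explicit:
  "H_plus d A x q = (if q = 0 then 0 else
     max (1 - A * d * (cos (x$1) * cos (x$2)) * (((q$1)\<^sup>2 - (q$2)\<^sup>2) / (norm q)\<^sup>2)) 0 * norm q
       + cell_flow A x \<bullet> q)"
proof -
  have "q \<bullet> (strain (cell_flow A) x *v q) = - (A * (cos (x$1) * cos (x$2)) * ((q$1)\<^sup>2 - (q$2)\<^sup>2))"
    by (simp add: strain_cell_flow inner_vec_def sum_2 matrix_vector_mult_def algebra_simps power2_eq_square)
  then have "1 + d * (q \<bullet> (strain (cell_flow A) x *v q)) / (norm q)\<^sup>2
      = 1 - A * d * (cos (x$1) * cos (x$2)) * (((q$1)\<^sup>2 - (q$2)\<^sup>2) / (norm q)\<^sup>2)"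
    by (simp only:) simp
  then show ?thesis unfolding H_plus_def by (simp only:)
qed

lemma norm_sq_2: "(norm (q :: real^2))\<^sup>2 = (q$1)\<^sup>2 + (q$2)\<^sup>2"
  unfolding power2_norm_eq_inner by (simp add: inner_vec_def sum_2 power2_eq_square)

lemma strain_quotient_bound: "\<bar>((q$1)\<^sup>2 - (q$2)\<^sup>2) / (norm (q :: real^2))\<^sup>2\<bar> \<le> 1"
proof -
  have "\<bar>(q$1)\<^sup>2 - (q$2)\<^sup>2\<bar> \<le> (q$1)\<^sup>2 + (q$2)\<^sup>2" by (simp add: abs_le_iff)
  then show ?thesis
    by (cases "q = 0") (simp_all add: abs_divide divide_le_eq_1_pos flip: norm_sq_2)
qed

lemma abs_sin_diff_le: "\<bar>sin a - sin b\<bar> \<le> \<bar>a - b\<bar>" for a b :: real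
proof -
  have "\<bar>sin a - sin b\<bar> = 2 * \<bar>sin ((a - b) / 2)\<bar> * \<bar>cos ((a + b) / 2)\<bar>"
    by (simp add: sin_diff_sin abs_mult)
  also have "\<dots> \<le> 2 * \<bar>(a - b) / 2\<bar> * 1"
    by (intro mult_mono abs_cos_le_one abs_sin_x_le_abs_x order_refl) auto
  finally show ?thesis by simp
qed

lemma abs_cos_diff_le: "\<bar>cos a - cos b\<bar> \<le> \<bar>a - b\<bar>" for a b :: real
  using abs_sin_diff_le[of "pi / 2 - a" "pi / 2 - b"] unfolding cos_sin_eq by (simp add: abs_minus_commute)

lemma product_diff_le:
  fixes a b c e :: real
  assumes "\<bar>a - c\<bar> \<le> r" "\<bar>b - e\<bar> \<le> r" "\<bar>b\<bar> \<le> 1" "\<bar>c\<bar> \<le> 1"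
  shows "\<bar>a * b - c * e\<bar> \<le> 2 * r"
proof -
  have r: "0 \<le> r" using assms(1) by linarith
  have "\<bar>(a - c) * b\<bar> \<le> r * 1" unfolding abs_mult by (intro mult_mono assms r) auto
  moreover have "\<bar>c * (b - e)\<bar> \<le> 1 * r" unfolding abs_mult by (intro mult_mono assms r) auto
  moreover have "a * b - c * e = (a - c) * b + c * (b - e)" by (simp add: algebra_simps)
  ultimately show ?thesis by linarith
qed

lemma H_plus_lipschitz:
  "H_plus d A x q \<le> H_plus d A y q + (2 * \<bar>A * d\<bar> + 4 * \<bar>A\<bar>) * norm (x - y) * norm q"
proof (cases "q = 0")
  case True
  then show ?thesis by (simp add: H_plus_def)
next
  case False
  define r where "r = norm (x - y)"
  have "\<bar>x$i - y$i\<bar> \<le> r" for i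
    using component_le_norm_cart[of "x - y" i] by (simp add: r_def)
  then have s: "\<bar>sin (x$i) - sin (y$i)\<bar> \<le> r" "\<bar>cos (x$i) - cos (y$i)\<bar> \<le> r" for i
    using abs_sin_diff_le[of "x$i" "y$i"] abs_cos_diff_le[of "x$i" "y$i"] by (meson order_trans)+
  define Q where "Q = ((q$1)\<^sup>2 - (q$2)\<^sup>2) / (norm q)\<^sup>2"
  define f where "f = (\<lambda>x :: real^2. 1 - A * d * (cos (x$1) * cos (x$2)) * Q)"
  have "\<bar>f x - f y\<bar> = \<bar>A * d\<bar> * \<bar>cos (x$1) * cos (x$2) - cos (y$1) * cos (y$2)\<bar> * \<bar>Q\<bar>"
    unfolding abs_mult[symmetric] f_def by (subst abs_minus_commute) (simp add: algebra_simps)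
  also have "\<dots> \<le> \<bar>A * d\<bar> * (2 * r) * 1"
    unfolding Q_def by (intro mult_mono product_diff_le s strain_quotient_bound) (auto simp: r_def)
  finally have "\<bar>f x - f y\<bar> \<le> 2 * \<bar>A * d\<bar> * r" by simp
  moreover have "0 \<le> 2 * \<bar>A * d\<bar> * r" by (simp add: r_def)
  ultimately have "max (f x) 0 \<le> max (f y) 0 + 2 * \<bar>A * d\<bar> * r" by linarith
  then have 1: "max (f x) 0 * norm q \<le> (max (f y) 0 + 2 * \<bar>A * d\<bar> * r) * norm q"
    by (rule mult_right_mono) simp
  have "norm (cell_flow A x - cell_flow A y) \<le> (\<Sum>i\<in>UNIV. \<bar>(cell_flow A x - cell_flow A y) $ i\<bar>)"
    by (rule norm_le_l1_cart)
  also have "\<dots> = \<bar>A\<bar> * \<bar>sin (x$1) * cos (x$2) - sin (y$1) * cos (y$2)\<bar>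
      + \<bar>A\<bar> * \<bar>cos (x$1) * sin (x$2) - cos (y$1) * sin (y$2)\<bar>"
    unfolding abs_mult[symmetric] sum_2 vector_minus_component cell_flow_nth
    by (subst abs_minus_commute) (simp add: algebra_simps)
  also have "\<dots> \<le> \<bar>A\<bar> * (2 * r) + \<bar>A\<bar> * (2 * r)"
    by (intro add_mono mult_left_mono product_diff_le s) auto
  finally have "norm (cell_flow A x - cell_flow A y) \<le> 4 * \<bar>A\<bar> * r" by (simp add: mult_ac)
  then have "(cell_flow A x - cell_flow A y) \<bullet> q \<le> 4 * \<bar>A\<bar> * r * norm q"
    using norm_cauchy_schwarz mult_right_mono[OF _ norm_ge_zero] by (meson order_trans)
  with 1 show ?thesis
    unfolding H_plus_explicit using False by (simp add: f_def Q_def r_def algebra_simps)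
qed

text \<open>A convex lower bound: the support function of the velocities \<open>V + a\<close> with
  \<open>|a| \<le> max (1 - A d |\<Phi>|) 0\<close>.\<close>

lemma H_plus_lower_bound:
  assumes "0 \<le> A * d"
  shows "cell_flow A x \<bullet> q + max (1 - A * d * \<bar>cos (x$1) * cos (x$2)\<bar>) 0 * norm q \<le> H_plus d A x q"
proof (cases "q = 0")
  case True
  then show ?thesis by (simp add: H_plus_def)
next
  case False
  define Q where "Q = ((q$1)\<^sup>2 - (q$2)\<^sup>2) / (norm q)\<^sup>2"
  have "cos (x$1) * cos (x$2) * Q \<le> \<bar>cos (x$1) * cos (x$2)\<bar> * \<bar>Q\<bar>"
    by (metis abs_ge_self abs_mult)
  also have "\<dots> \<le> \<bar>cos (x$1) * cos (x$2)\<bar> * 1"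
    unfolding Q_def by (intro mult_left_mono strain_quotient_bound) auto
  finally have "A * d * (cos (x$1) * cos (x$2) * Q) \<le> A * d * \<bar>cos (x$1) * cos (x$2)\<bar>"
    by (intro mult_left_mono assms) simp
  then have "max (1 - A * d * \<bar>cos (x$1) * cos (x$2)\<bar>) 0 * norm q
      \<le> max (1 - A * d * (cos (x$1) * cos (x$2)) * Q) 0 * norm q"
    by (intro mult_right_mono max.mono) (auto simp: mult.assoc)
  then show ?thesis unfolding H_plus_explicit using False by (simp add: Q_def)
qed

lemma flat_segment_compact: "compact (flat_segment \<mu>)" and flat_segment_convex: "convex (flat_segment \<mu>)"
proof -
  have "flat_segment \<mu> = cbox (vector [pi - arccos (1/\<mu>), 0]) (vector [pi + arccos (1/\<mu>), 0])"
    by (auto simp: flat_segment_def mem_box_cart forall_2)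
  then show "compact (flat_segment \<mu>)" "convex (flat_segment \<mu>)" by (simp_all add: compact_cbox)
qed

lemma H_plus_flat_segment_nonpos:
  fixes A d :: real
  defines "\<mu> \<equiv> A * d"
  assumes d: "0 < d" and \<mu>: "sqrt (1 + 4 * d\<^sup>2) < \<mu>"
    and x: "x \<in> flat_segment \<mu>"
    and q: "\<And>y. y \<in> flat_segment \<mu> \<Longrightarrow> 0 \<le> q \<bullet> (y - x)"
  shows "H_plus d A x q \<le> 0"
proof (cases "q = 0")
  case True
  then show ?thesis by (simp add: H_plus_def)
next
  case False
  define r where "r = arccos (1 / \<mu>)"
  have "1 \<le> sqrt (1 + 4 * d\<^sup>2)" by simp
  then have \<mu>1: "1 < \<mu>" using \<mu> by linarith
  then have "0 < A * d" by (simp add: \<mu>_def)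
  then have A: "0 < A" using d by (simp add: zero_less_mult_iff)
  have cr: "cos r = 1 / \<mu>" using \<mu>1 by (simp add: r_def field_simps)
  have r: "0 < r" "r < pi / 2"
  proof -
    have "0 < 1 / \<mu>" "1 / \<mu> < 1" using \<mu>1 by simp_all
    then have "arccos 1 < arccos (1 / \<mu>)" "arccos (1 / \<mu>) < arccos 0"
      by (intro arccos_less_arccos; linarith)+
    then show "0 < r" "r < pi / 2" by (simp_all add: r_def)
  qed
  have x1: "pi - r \<le> x$1" "x$1 \<le> pi + r" and x2: "x$2 = 0"
    using x by (auto simp: flat_segment_def r_def)
  define w where "w = x$1 - pi"
  have w: "\<bar>w\<bar> \<le> r" and xw: "x$1 = pi + w" using x1 by (auto simp: w_def)
  have coef: "1 / \<mu> \<le> cos w"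
    using cos_monotone_0_pi_le[of "\<bar>w\<bar>" r] w r cr by simp
  then have c1: "1 \<le> \<mu> * cos w" using \<mu>1 by (simp add: field_simps)
  have q1: "0 \<le> q$1 * (s - x$1)" if "pi - r \<le> s" "s \<le> pi + r" for s
    using q[of "vector [s, 0]"] that x2 by (simp add: flat_segment_def r_def inner_vec_def sum_2)
  have H: "H_plus d A x q = max (1 + \<mu> * cos w * (((q$1)\<^sup>2 - (q$2)\<^sup>2) / (norm q)\<^sup>2)) 0 * norm q
      + A * sin w * q$1"
    unfolding H_plus_explicit using False
    by (simp add: inner_vec_def sum_2 cell_flow_nth x2 xw \<mu>_def)
  show ?thesis
  proof (cases "q$1 = 0")
    case True
    then have "(norm q)\<^sup>2 = (q$2)\<^sup>2" "q$2 \<noteq> 0" using False by (auto simp: norm_sq_2 vec_eq_iff forall_2)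
    then show ?thesis using True c1 unfolding H by simp
  next
    case q1nz: False
    \<comment> \<open>A covector with a horizontal component is only normal at an endpoint, where it points inward.\<close>
    have neg: "w = r" if "q$1 < 0" using q1[of "pi + r"] that xw w r by (auto simp: zero_le_mult_iff)
    have pos: "w = - r" if "0 < q$1" using q1[of "pi - r"] that xw w r by (auto simp: zero_le_mult_iff)
    have "cos w = 1 / \<mu>" "A * sin w * q$1 = - (A * sin r * \<bar>q$1\<bar>)"
      using neg pos q1nz cr by (cases "q$1 < 0"; auto)+
    then have "H_plus d A x q = max (1 + ((q$1)\<^sup>2 - (q$2)\<^sup>2) / (norm q)\<^sup>2) 0 * norm q - A * sin r * \<bar>q$1\<bar>"
      using \<mu>1 by (simp add: H)
    also have "1 + ((q$1)\<^sup>2 - (q$2)\<^sup>2) / (norm q)\<^sup>2 = 2 * (q$1)\<^sup>2 / (norm q)\<^sup>2"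
      using False by (simp add: divide_simps) (simp add: norm_sq_2)
    also have "max \<dots> 0 * norm q = 2 * \<bar>q$1\<bar> * (\<bar>q$1\<bar> / norm q)"
      using False by (simp add: power2_eq_square)
    also have "\<dots> \<le> 2 * \<bar>q$1\<bar> * 1"
      using component_le_norm_cart[of q 1] False by (intro mult_left_mono) auto
    also have "2 * \<bar>q$1\<bar> * 1 \<le> A * sin r * \<bar>q$1\<bar>"
    proof -
      have "(sin r)\<^sup>2 = 1 - (1 / \<mu>)\<^sup>2" using sin_squared_eq[of r] cr by simp
      then have sq: "(A * sin r)\<^sup>2 = (\<mu>\<^sup>2 - 1) / d\<^sup>2"
        using A d by (simp add: power_mult_distrib \<mu>_def field_simps)
      have "1 + 4 * d\<^sup>2 < \<mu>\<^sup>2"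
        using power_strict_mono[OF \<mu>, of 2] by simp
      then have "2\<^sup>2 \<le> (A * sin r)\<^sup>2" unfolding sq using d by (simp add: pos_le_divide_eq)
      moreover have "0 \<le> A * sin r" using A r by (intro mult_nonneg_nonneg sin_ge_zero) auto
      ultimately have "2 \<le> A * sin r" by (rule power2_le_imp_le)
      then show ?thesis by (simp add: mult_right_mono)
    qed
    finally show ?thesis by simp
  qed
qed

section \<open>Paths around a hyperbolic stagnation point\<close>

text \<open>The affine map \<open>z \<mapsto> P + L z\<close> is an isometry that carries the cellular flow to itself and
  preserves \<open>|\<Phi>|\<close>, the only feature of the strain that enters the admissible controls.\<close>

definition flow_symmetry :: "real^2 \<Rightarrow> (real^2 \<Rightarrow> real^2) \<Rightarrow> bool" where
  "flow_symmetry P L \<longleftrightarrow> bounded_linear L \<and> (\<forall>z. norm (L z) = norm z) \<and>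
     (\<forall>A z. cell_flow A (P + L z) = L (cell_flow A z)) \<and>
     (\<forall>z. \<bar>cos ((P + L z)$1) * cos ((P + L z)$2)\<bar> = \<bar>cos (z$1) * cos (z$2)\<bar>)"

lemma vec2_eq_iff: "(x :: real^2) = y \<longleftrightarrow> x$1 = y$1 \<and> x$2 = y$2"
  by (simp add: vec_eq_iff forall_2)

lemma vector2_axis: "vector [a, b] = a *\<^sub>R axis 1 1 + b *\<^sub>R (axis 2 1 :: real^2)"
  by (simp add: vec2_eq_iff axis_def)

lemma sin_cos_int_pi_plus:
  fixes m :: int and x :: real
  shows "sin (of_int m * pi + x) = (if even m then sin x else - sin x)"
    "cos (of_int m * pi + x) = (if even m then cos x else - cos x)"
  by (simp_all add: sin_add cos_add mult.commute[of _ pi])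

text \<open>The hyperbolic stagnation points are \<open>(m \<pi>, n \<pi>)\<close>. The flow comes in horizontally and leaves vertically
  when \<open>m + n\<close> is even, and the other way round when it is odd; in the odd case the symmetry exchanges
  the coordinates.\<close>

lemma flow_symmetry_even:
  assumes "even (m + n)" "e \<in> {1, -1}" "f \<in> {1, -1}"
  shows "flow_symmetry (vector [of_int m * pi, of_int n * pi]) (\<lambda>z :: real^2. vector [e * z$1, f * z$2])"
  unfolding flow_symmetry_def
proof (intro conjI allI)
  show "bounded_linear (\<lambda>z :: real^2. vector [e * z$1, f * z$2] :: real^2)"
    unfolding vector2_axis by (intro bounded_linear_intros bounded_linear_vec_nth)
  show "norm (vector [e * z$1, f * z$2] :: real^2) = norm z" for z :: "real^2"
    using assms by (auto simp: norm_eq_sqrt_inner inner_vec_def sum_2)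
qed (use assms in \<open>auto simp: vec2_eq_iff cell_flow_nth sin_cos_int_pi_plus abs_mult\<close>)

lemma flow_symmetry_odd:
  assumes "odd (m + n)" "e \<in> {1, -1}" "f \<in> {1, -1}"
  shows "flow_symmetry (vector [of_int m * pi, of_int n * pi]) (\<lambda>z :: real^2. vector [e * z$2, f * z$1])"
  unfolding flow_symmetry_def
proof (intro conjI allI)
  show "bounded_linear (\<lambda>z :: real^2. vector [e * z$2, f * z$1] :: real^2)"
    unfolding vector2_axis by (intro bounded_linear_intros bounded_linear_vec_nth)
  show "norm (vector [e * z$2, f * z$1] :: real^2) = norm z" for z :: "real^2"
    using assms by (auto simp: norm_eq_sqrt_inner inner_vec_def sum_2)
qed (use assms in \<open>auto simp: vec2_eq_iff cell_flow_nth sin_cos_int_pi_plus abs_mult\<close>)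

text \<open>It suffices to exhibit controlled paths around the origin.\<close>

lemma symmetric_path:
  fixes g a :: "real \<Rightarrow> real^2"
  assumes Ad: "0 \<le> A * d"
    and sub: "visc_subsolution (H_plus d A) G" and cont: "continuous_on (UNIV \<times> {0..}) G"
    and sym: "flow_symmetry P L"
    and \<alpha>\<beta>: "\<alpha> \<le> \<beta>"
    and g: "\<And>\<sigma>. \<sigma> \<in> {\<alpha>..\<beta>} \<Longrightarrow>
      (g has_vector_derivative \<rho> \<sigma> *\<^sub>R (cell_flow A (g \<sigma>) + a \<sigma>)) (at \<sigma> within {\<alpha>..\<beta>})"
    and a: "\<And>\<sigma>. \<sigma> \<in> {\<alpha>..\<beta>} \<Longrightarrow>
      norm (a \<sigma>) \<le> max (1 - A * d * \<bar>cos (g \<sigma> $ 1) * cos (g \<sigma> $ 2)\<bar>) 0"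
    and c\<rho>: "continuous_on {\<alpha>..\<beta>} \<rho>"
    and \<rho>: "\<And>\<sigma>. \<sigma> \<in> {\<alpha>..\<beta>} \<Longrightarrow> 0 \<le> \<rho> \<sigma>" "\<And>\<sigma>. \<sigma> \<in> {\<alpha>..\<beta>} \<Longrightarrow> \<rho> \<sigma> \<le> B"
  shows "reaches G (P + L (g \<alpha>)) (P + L (g \<beta>)) (B * (\<beta> - \<alpha>))"
proof -
  have L: "bounded_linear L" "\<And>z. norm (L z) = norm z"
      "\<And>z. cell_flow A (P + L z) = L (cell_flow A z)"
      "\<And>z. \<bar>cos ((P + L z)$1) * cos ((P + L z)$2)\<bar> = \<bar>cos (z$1) * cos (z$2)\<bar>"
    using sym unfolding flow_symmetry_def by blast+
  interpret L: bounded_linear L by (rule L(1))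
  show ?thesis
  proof (rule transport[OF sub cont H_plus_lipschitz _ \<alpha>\<beta> _ c\<rho> \<rho>,
      where \<gamma>' = "\<lambda>\<sigma>. L (\<rho> \<sigma> *\<^sub>R (cell_flow A (g \<sigma>) + a \<sigma>))"])
    fix \<sigma> assume \<sigma>: "\<sigma> \<in> {\<alpha>..\<beta>}"
    show "((\<lambda>\<sigma>. P + L (g \<sigma>)) has_vector_derivative L (\<rho> \<sigma> *\<^sub>R (cell_flow A (g \<sigma>) + a \<sigma>)))
        (at \<sigma> within {\<alpha>..\<beta>})"
      using has_vector_derivative_add[OF has_vector_derivative_const[of P] L.has_vector_derivative[OF g[OF \<sigma>]]]
      by simp
    fix q
    have "L (\<rho> \<sigma> *\<^sub>R (cell_flow A (g \<sigma>) + a \<sigma>)) \<bullet> q = \<rho> \<sigma> * (cell_flow A (P + L (g \<sigma>)) \<bullet> q + L (a \<sigma>) \<bullet> q)"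
      by (simp add: L.add L.scaleR L(3) algebra_simps)
    also have "\<dots> \<le> \<rho> \<sigma> * H_plus d A (P + L (g \<sigma>)) q"
    proof (intro mult_left_mono \<rho>(1)[OF \<sigma>])
      have "L (a \<sigma>) \<bullet> q \<le> norm (a \<sigma>) * norm q"
        using norm_cauchy_schwarz[of "L (a \<sigma>)" q] by (simp add: L(2))
      also have "\<dots> \<le> max (1 - A * d * \<bar>cos (g \<sigma> $ 1) * cos (g \<sigma> $ 2)\<bar>) 0 * norm q"
        by (intro mult_right_mono a[OF \<sigma>]) simp
      finally show "cell_flow A (P + L (g \<sigma>)) \<bullet> q + L (a \<sigma>) \<bullet> q \<le> H_plus d A (P + L (g \<sigma>)) q"
        using H_plus_lower_bound[OF Ad, of "P + L (g \<sigma>)" q] L(4)[of "g \<sigma>"] by simp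
    qed
    finally show "L (\<rho> \<sigma> *\<^sub>R (cell_flow A (g \<sigma>) + a \<sigma>)) \<bullet> q \<le> \<rho> \<sigma> * H_plus d A (P + L (g \<sigma>)) q" .
  qed auto
qed

lemma has_vector_derivative_vector2:
  fixes f g :: "real \<Rightarrow> real"
  assumes "(f has_real_derivative f') (at x within S)" "(g has_real_derivative g') (at x within S)"
  shows "((\<lambda>\<sigma>. vector [f \<sigma>, g \<sigma>] :: real^2) has_vector_derivative vector [f', g']) (at x within S)"
  unfolding vector2_axis
  by (intro has_vector_derivative_add has_vector_derivative_scaleR[OF _ has_vector_derivative_const, simplified] assms)

lemma half_le_cos: "1 / 2 \<le> cos x" if "\<bar>x\<bar> \<le> pi / 3"
  using cos_monotone_0_pi_le[of "\<bar>x\<bar>" "pi / 3"] that by (simp add: cos_60)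

text \<open>The control needed to move along a straight line of slope \<open>\<kappa> = 1/(8A)\<close> while crossing the middle
  third of an edge. There \<open>|\<Phi>| = |sin \<sigma> cos (\<kappa> \<sigma>)| \<le> 1/2\<close> with \<open>\<sigma>\<close> the distance to the midpoint
  along the edge, so with \<open>A d \<le> 3/2\<close> the available speed is at least \<open>1/4\<close>, whereas
  the required one is at most \<open>2 A \<kappa> = 1/4\<close>.\<close>

lemma climb_control:
  fixes A \<sigma> :: real
  defines "\<kappa> \<equiv> 1 / (8 * A)"
  assumes A: "1 \<le> A" and Ad: "0 \<le> A * d" "A * d \<le> 3 / 2" and \<sigma>: "\<bar>\<sigma>\<bar> \<le> pi / 6"
  shows "\<bar>A * (\<kappa> * (cos \<sigma> * cos (\<kappa> * \<sigma>)) - sin \<sigma> * sin (\<kappa> * \<sigma>))\<bar>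
      \<le> max (1 - A * d * \<bar>sin \<sigma> * cos (\<kappa> * \<sigma>)\<bar>) 0" (is ?control)
    and "1 / 2 \<le> cos \<sigma>" "1 / 2 \<le> cos (\<kappa> * \<sigma>)"
    and "1 / (A * (cos \<sigma> * cos (\<kappa> * \<sigma>))) \<le> 4 / A"
proof -
  have \<sigma>1: "\<bar>\<sigma>\<bar> \<le> 1" using \<sigma> pi_less_4 by linarith
  have \<kappa>: "0 < \<kappa>" "\<kappa> \<le> 1" "A * \<kappa> = 1 / 8" using A by (auto simp: \<kappa>_def field_simps)
  have \<kappa>\<sigma>: "\<bar>\<kappa> * \<sigma>\<bar> \<le> \<bar>\<sigma>\<bar>" using \<kappa> by (simp add: abs_mult mult_left_le_one_le)
  show c: "1 / 2 \<le> cos \<sigma>" "1 / 2 \<le> cos (\<kappa> * \<sigma>)"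
    using \<sigma> \<kappa>\<sigma> by (intro half_le_cos; linarith)+
  have "(1 / 2) * (1 / 2) \<le> cos \<sigma> * cos (\<kappa> * \<sigma>)"
    using c by (intro mult_mono) auto
  then have "A * (1 / 4) \<le> A * (cos \<sigma> * cos (\<kappa> * \<sigma>))" using A by (intro mult_left_mono) auto
  then show "1 / (A * (cos \<sigma> * cos (\<kappa> * \<sigma>))) \<le> 4 / A"
    using A frac_le[of 1 1 "A * (1 / 4)"] by simp
  have "\<bar>\<kappa> * (cos \<sigma> * cos (\<kappa> * \<sigma>))\<bar> \<le> \<kappa> * (1 * 1)"
    using \<kappa> unfolding abs_mult by (intro mult_mono) auto
  moreover have "\<bar>sin \<sigma> * sin (\<kappa> * \<sigma>)\<bar> \<le> 1 * (\<kappa> * 1)"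
    unfolding abs_mult
  proof (intro mult_mono)
    have "\<bar>sin (\<kappa> * \<sigma>)\<bar> \<le> \<kappa> * \<bar>\<sigma>\<bar>" using abs_sin_x_le_abs_x[of "\<kappa> * \<sigma>"] \<kappa> by (simp add: abs_mult)
    also have "\<dots> \<le> \<kappa> * 1" using \<sigma>1 \<kappa> by (intro mult_left_mono) auto
    finally show "\<bar>sin (\<kappa> * \<sigma>)\<bar> \<le> \<kappa> * 1" .
  qed auto
  ultimately have "\<bar>\<kappa> * (cos \<sigma> * cos (\<kappa> * \<sigma>)) - sin \<sigma> * sin (\<kappa> * \<sigma>)\<bar> \<le> 2 * \<kappa>" by linarith
  then have "A * \<bar>\<kappa> * (cos \<sigma> * cos (\<kappa> * \<sigma>)) - sin \<sigma> * sin (\<kappa> * \<sigma>)\<bar> \<le> A * (2 * \<kappa>)"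
    using A by (intro mult_left_mono) auto
  also have "A * (2 * \<kappa>) = 1 / 4" using \<kappa>(3) by simp
  finally have 1: "\<bar>A * (\<kappa> * (cos \<sigma> * cos (\<kappa> * \<sigma>)) - sin \<sigma> * sin (\<kappa> * \<sigma>))\<bar> \<le> 1 / 4"
    using A by (simp add: abs_mult)
  have "\<bar>sin \<sigma>\<bar> \<le> 1 / 2"
    using sin_monotone_2pi_le[of "\<bar>\<sigma>\<bar>" "pi / 6"] \<sigma> sin_ge_zero[of "\<bar>\<sigma>\<bar>"]
    by (cases "0 \<le> \<sigma>") (auto simp: sin_30)
  then have "\<bar>sin \<sigma> * cos (\<kappa> * \<sigma>)\<bar> \<le> 1 / 2 * 1"
    unfolding abs_mult by (intro mult_mono) auto
  then have "A * d * \<bar>sin \<sigma> * cos (\<kappa> * \<sigma>)\<bar> \<le> 3 / 2 * (1 / 2 * 1)"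
    using Ad by (intro mult_mono) auto
  with 1 show ?control by linarith
qed

lemma climb_from_edge:
  fixes A :: real
  defines "\<kappa> \<equiv> 1 / (8 * A)"
  assumes A: "1 \<le> A" and Ad: "0 \<le> A * d" "A * d \<le> 3 / 2"
    and sub: "visc_subsolution (H_plus d A) G" and cont: "continuous_on (UNIV \<times> {0..}) G"
    and sym: "flow_symmetry P L"
  shows "reaches G (P + L (vector [pi / 2, 0])) (P + L (vector [pi / 3, \<kappa> * (pi / 6)])) (4 / A)"
proof -
  define g :: "real \<Rightarrow> real^2" where "g = (\<lambda>\<sigma>. vector [pi / 2 - \<sigma>, \<kappa> * \<sigma>])"
  define \<rho> where "\<rho> = (\<lambda>\<sigma>. 1 / (A * (cos \<sigma> * cos (\<kappa> * \<sigma>))))"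
  define a :: "real \<Rightarrow> real^2"
    where "a = (\<lambda>\<sigma>. vector [0, A * (\<kappa> * (cos \<sigma> * cos (\<kappa> * \<sigma>)) - sin \<sigma> * sin (\<kappa> * \<sigma>))])"
  note cc = climb_control[OF A Ad, folded \<kappa>_def]
  have rng: "\<bar>\<sigma>\<bar> \<le> pi / 6" if "\<sigma> \<in> {0..pi/6}" for \<sigma> using that by auto
  have nz: "cos \<sigma> \<noteq> 0" "cos (\<kappa> * \<sigma>) \<noteq> 0" "0 \<le> cos \<sigma>" "0 \<le> cos (\<kappa> * \<sigma>)" if "\<sigma> \<in> {0..pi/6}" for \<sigma>
    using cc(2,3)[OF rng[OF that]] by auto
  have "reaches G (P + L (g 0)) (P + L (g (pi / 6))) (4 / A * (pi / 6 - 0))"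
  proof (rule symmetric_path[OF Ad(1) sub cont sym, where \<rho> = \<rho> and a = a])
    fix \<sigma> :: real assume \<sigma>: "\<sigma> \<in> {0..pi/6}"
    have "((\<lambda>\<sigma>. pi / 2 - \<sigma>) has_real_derivative - 1) (at \<sigma> within {0..pi/6})"
      "((\<lambda>\<sigma>. \<kappa> * \<sigma>) has_real_derivative \<kappa>) (at \<sigma> within {0..pi/6})"
      by (auto intro!: derivative_eq_intros)
    from has_vector_derivative_vector2[OF this]
    have "(g has_vector_derivative vector [-1, \<kappa>]) (at \<sigma> within {0..pi/6})" by (simp add: g_def)
    moreover have "cell_flow A (g \<sigma>) $ 1 = - (A * (cos \<sigma> * cos (\<kappa> * \<sigma>)))"
        "cell_flow A (g \<sigma>) $ 2 = A * (sin \<sigma> * sin (\<kappa> * \<sigma>))"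
      by (simp_all add: cell_flow_nth g_def sin_diff cos_diff)
    then have "\<rho> \<sigma> *\<^sub>R (cell_flow A (g \<sigma>) + a \<sigma>) = vector [-1, \<kappa>]"
      using A nz[OF \<sigma>] by (simp add: vec2_eq_iff a_def \<rho>_def field_simps)
    ultimately show "(g has_vector_derivative \<rho> \<sigma> *\<^sub>R (cell_flow A (g \<sigma>) + a \<sigma>)) (at \<sigma> within {0..pi/6})"
      by simp
    show "norm (a \<sigma>) \<le> max (1 - A * d * \<bar>cos (g \<sigma> $ 1) * cos (g \<sigma> $ 2)\<bar>) 0"
      using cc(1)[OF rng[OF \<sigma>]]
      by (simp add: a_def g_def norm_eq_sqrt_inner inner_vec_def sum_2 cos_diff)
    show "0 \<le> \<rho> \<sigma>" using A nz[OF \<sigma>] by (simp add: \<rho>_def)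
    show "\<rho> \<sigma> \<le> 4 / A" using cc(4)[OF rng[OF \<sigma>]] by (simp add: \<rho>_def)
  next
    show "continuous_on {0..pi/6} \<rho>"
      unfolding \<rho>_def by (intro continuous_intros) (use A nz in auto)
  qed auto
  moreover have "4 / A * (pi / 6 - 0) \<le> 4 / A" using A pi_less_4 by (simp add: field_simps)
  ultimately show ?thesis by (auto simp: g_def reaches_def intro: order_trans)
qed

lemma descend_to_edge:
  fixes A :: real
  defines "\<kappa> \<equiv> 1 / (8 * A)"
  assumes A: "1 \<le> A" and Ad: "0 \<le> A * d" "A * d \<le> 3 / 2"
    and sub: "visc_subsolution (H_plus d A) G" and cont: "continuous_on (UNIV \<times> {0..}) G"
    and sym: "flow_symmetry P L"
  shows "reaches G (P + L (vector [\<kappa> * (pi / 6), pi / 3])) (P + L (vector [0, pi / 2])) (4 / A)"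
proof -
  define g :: "real \<Rightarrow> real^2" where "g = (\<lambda>\<sigma>. vector [- (\<kappa> * \<sigma>), pi / 2 + \<sigma>])"
  define \<rho> where "\<rho> = (\<lambda>\<sigma>. 1 / (A * (cos \<sigma> * cos (\<kappa> * \<sigma>))))"
  define a :: "real \<Rightarrow> real^2"
    where "a = (\<lambda>\<sigma>. vector [- (A * (\<kappa> * (cos \<sigma> * cos (\<kappa> * \<sigma>)) - sin \<sigma> * sin (\<kappa> * \<sigma>))), 0])"
  note cc = climb_control[OF A Ad, folded \<kappa>_def]
  have rng: "\<bar>\<sigma>\<bar> \<le> pi / 6" if "\<sigma> \<in> {-(pi/6)..0}" for \<sigma> using that by auto
  have nz: "cos \<sigma> \<noteq> 0" "cos (\<kappa> * \<sigma>) \<noteq> 0" "0 \<le> cos \<sigma>" "0 \<le> cos (\<kappa> * \<sigma>)" if "\<sigma> \<in> {-(pi/6)..0}" for \<sigma>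
    using cc(2,3)[OF rng[OF that]] by auto
  have "reaches G (P + L (g (-(pi/6)))) (P + L (g 0)) (4 / A * (0 - (-(pi/6))))"
  proof (rule symmetric_path[OF Ad(1) sub cont sym, where \<rho> = \<rho> and a = a])
    fix \<sigma> :: real assume \<sigma>: "\<sigma> \<in> {-(pi/6)..0}"
    have "((\<lambda>\<sigma>. - (\<kappa> * \<sigma>)) has_real_derivative - \<kappa>) (at \<sigma> within {-(pi/6)..0})"
      "((\<lambda>\<sigma>. pi / 2 + \<sigma>) has_real_derivative 1) (at \<sigma> within {-(pi/6)..0})"
      by (auto intro!: derivative_eq_intros)
    from has_vector_derivative_vector2[OF this]
    have "(g has_vector_derivative vector [-\<kappa>, 1]) (at \<sigma> within {-(pi/6)..0})" by (simp add: g_def)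
    moreover have "cell_flow A (g \<sigma>) $ 1 = - (A * (sin \<sigma> * sin (\<kappa> * \<sigma>)))"
        "cell_flow A (g \<sigma>) $ 2 = A * (cos \<sigma> * cos (\<kappa> * \<sigma>))"
      by (simp_all add: cell_flow_nth g_def sin_add cos_add)
    then have "\<rho> \<sigma> *\<^sub>R (cell_flow A (g \<sigma>) + a \<sigma>) = vector [-\<kappa>, 1]"
      using A nz[OF \<sigma>] by (simp add: vec2_eq_iff a_def \<rho>_def field_simps)
    ultimately show "(g has_vector_derivative \<rho> \<sigma> *\<^sub>R (cell_flow A (g \<sigma>) + a \<sigma>)) (at \<sigma> within {-(pi/6)..0})"
      by simp
    show "norm (a \<sigma>) \<le> max (1 - A * d * \<bar>cos (g \<sigma> $ 1) * cos (g \<sigma> $ 2)\<bar>) 0"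
      using cc(1)[OF rng[OF \<sigma>]]
      by (simp add: a_def g_def norm_eq_sqrt_inner inner_vec_def sum_2 cos_add mult.commute)
    show "0 \<le> \<rho> \<sigma>" using A nz[OF \<sigma>] by (simp add: \<rho>_def)
    show "\<rho> \<sigma> \<le> 4 / A" using cc(4)[OF rng[OF \<sigma>]] by (simp add: \<rho>_def)
  next
    show "continuous_on {-(pi/6)..0} \<rho>"
      unfolding \<rho>_def by (intro continuous_intros) (use A nz in auto)
  qed auto
  moreover have "4 / A * (0 - (-(pi/6))) \<le> 4 / A" using A pi_less_4 by (simp add: field_simps)
  ultimately show ?thesis by (auto simp: g_def reaches_def intro: order_trans)
qed

lemma half_le_sin: "x / 2 \<le> sin x" if "0 \<le> x" "x \<le> 1" for x :: real
proof -
  have "\<bar>sin x - x\<bar> \<le> x\<^sup>2 / 2"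
    using Maclaurin_sin_bound[of x 2] that
    by (simp add: numeral_2_eq_2 sin_coeff_def)
  moreover have "x\<^sup>2 \<le> x" using that by (simp add: power2_eq_square mult_left_le)
  ultimately show ?thesis by linarith
qed

text \<open>An uncontrolled passage of the stagnation point along the level set \<open>sin x\<^sub>1 sin x\<^sub>2 = const\<close>, with
  parametrisation \<open>sin x\<^sub>1 = b e\<^sup>-\<^sup>\<sigma>\<close>, \<open>sin x\<^sub>2 = c e\<^sup>\<sigma>\<close>. Time per unit of \<open>\<sigma>\<close> is \<open>1 / (A cos x\<^sub>1 cos x\<^sub>2) \<le> 4 / A\<close>, and the
  range of \<open>\<sigma>\<close> has length \<open>ln (b / c) \<le> 3 ln A\<close>.\<close>

lemma turn_corner:
  fixes A :: real
  defines "h \<equiv> 1 / (8 * A) * (pi / 6)"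
  assumes A: "19 \<le> A" and Ad: "0 \<le> A * d"
    and sub: "visc_subsolution (H_plus d A) G" and cont: "continuous_on (UNIV \<times> {0..}) G"
    and sym: "flow_symmetry P L"
  shows "reaches G (P + L (vector [pi / 3, h])) (P + L (vector [h, pi / 3])) (12 * ln A / A)"
proof -
  define b where "b = sin (pi / 3)"
  define c where "c = sin h"
  define S where "S = ln (b / c)"
  have h: "0 < h" "h \<le> 1" "1 / (32 * A) \<le> h / 2"
    using A pi_gt3 pi_less_4 by (auto simp: h_def field_simps)
  have h3: "h < pi / 3" using h A pi_gt3 by (simp add: h_def field_simps)
  have b: "0 < b" "b\<^sup>2 = 3 / 4" by (simp_all add: b_def sin_60 power_divide)
  have b1: "b < 1" by (rule power2_less_imp_less) (use b in simp_all)
  have c: "0 < c" "1 / (32 * A) \<le> c"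
    using half_le_sin[of h] h A by (auto simp: c_def intro: order_trans sin_gt_zero_02)
  have cb: "c < b" unfolding b_def c_def
    by (rule sin_monotone_2pi) (use h h3 pi_gt_zero in linarith)+
  have S: "0 < S" using b c cb by (simp add: S_def)
  have eS: "exp S = b / c" "exp (- S) = c / b" using b c by (simp_all add: S_def exp_minus)
  have "b / c \<le> 32 * A"
  proof -
    have "b / c \<le> 1 / (1 / (32 * A))" using b b1 c A by (intro frac_le) auto
    then show ?thesis by simp
  qed
  also have "32 * A \<le> A ^ 3"
    using A mult_mono[of 19 A 19 A] by (simp add: power3_eq_cube mult_right_mono)
  finally have "S \<le> ln (A ^ 3)" unfolding S_def using b c A by (intro ln_mono) auto
  also have "\<dots> = 3 * ln A" using A by (simp add: ln_realpow)
  finally have S3: "S \<le> 3 * ln A" .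
  define u where "u = (\<lambda>\<sigma>. b * exp (- \<sigma>))"
  define v where "v = (\<lambda>\<sigma>. c * exp \<sigma>)"
  define g :: "real \<Rightarrow> real^2" where "g = (\<lambda>\<sigma>. vector [arcsin (u \<sigma>), arcsin (v \<sigma>)])"
  define \<rho> where "\<rho> = (\<lambda>\<sigma>. 1 / (A * (sqrt (1 - (u \<sigma>)\<^sup>2) * sqrt (1 - (v \<sigma>)\<^sup>2))))"
  have uv: "0 < u \<sigma>" "u \<sigma> \<le> b" "0 < v \<sigma>" "v \<sigma> \<le> b" if "\<sigma> \<in> {0..S}" for \<sigma>
  proof -
    have "c * exp \<sigma> \<le> c * exp S" using that c by (intro mult_left_mono) auto
    then show "v \<sigma> \<le> b" using eS c by (simp add: v_def)
    have "b * exp (- \<sigma>) \<le> b * 1" using that b by (intro mult_left_mono) auto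
    then show "u \<sigma> \<le> b" by (simp add: u_def)
  qed (use b c in \<open>simp_all add: u_def v_def\<close>)
  have half: "1 / 2 \<le> sqrt (1 - w\<^sup>2)" if "0 < w" "w \<le> b" for w
  proof (rule real_le_rsqrt)
    have "w\<^sup>2 \<le> b\<^sup>2" using that by (intro power_mono) auto
    then show "(1 / 2)\<^sup>2 \<le> 1 - w\<^sup>2" using b by (simp add: power2_eq_square)
  qed
  have "reaches G (P + L (g 0)) (P + L (g S)) (4 / A * (S - 0))"
  proof (rule symmetric_path[OF Ad sub cont sym, where \<rho> = \<rho> and a = "\<lambda>\<sigma>. 0"])
    fix \<sigma> :: real assume \<sigma>: "\<sigma> \<in> {0..S}"
    note uv' = uv[OF \<sigma>]
    define su where "su = sqrt (1 - (u \<sigma>)\<^sup>2)"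
    define sv where "sv = sqrt (1 - (v \<sigma>)\<^sup>2)"
    have su: "1 / 2 \<le> su" "1 / 2 \<le> sv" using half uv' by (auto simp: su_def sv_def)
    have arc: "sin (arcsin (u \<sigma>)) = u \<sigma>" "sin (arcsin (v \<sigma>)) = v \<sigma>"
        "cos (arcsin (u \<sigma>)) = su" "cos (arcsin (v \<sigma>)) = sv"
      using uv' b1 by (auto simp: su_def sv_def cos_arcsin)
    have du: "(u has_real_derivative - u \<sigma>) (at \<sigma> within {0..S})"
      and dv: "(v has_real_derivative v \<sigma>) (at \<sigma> within {0..S})"
      unfolding u_def v_def by (auto intro!: derivative_eq_intros)
    have "((\<lambda>\<sigma>. arcsin (u \<sigma>)) has_real_derivative inverse su * (- u \<sigma>)) (at \<sigma> within {0..S})"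
      unfolding su_def by (rule DERIV_chain2[OF DERIV_arcsin du]) (use uv' b1 in auto)
    moreover have "((\<lambda>\<sigma>. arcsin (v \<sigma>)) has_real_derivative inverse sv * v \<sigma>) (at \<sigma> within {0..S})"
      unfolding sv_def by (rule DERIV_chain2[OF DERIV_arcsin dv]) (use uv' b1 in auto)
    ultimately have "(g has_vector_derivative vector [inverse su * (- u \<sigma>), inverse sv * v \<sigma>]) (at \<sigma> within {0..S})"
      unfolding g_def by (rule has_vector_derivative_vector2)
    moreover have "\<rho> \<sigma> *\<^sub>R (cell_flow A (g \<sigma>) + 0) = vector [inverse su * (- u \<sigma>), inverse sv * v \<sigma>]"
      using A su by (simp add: vec2_eq_iff cell_flow_nth g_def arc \<rho>_def field_simps flip: su_def sv_def)
    ultimately show "(g has_vector_derivative \<rho> \<sigma> *\<^sub>R (cell_flow A (g \<sigma>) + 0)) (at \<sigma> within {0..S})"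
      by simp
    have "(1 / 2) * (1 / 2) \<le> su * sv" using su by (intro mult_mono) auto
    then have "A * (1 / 4) \<le> A * (su * sv)" using A by (intro mult_left_mono) auto
    then show "\<rho> \<sigma> \<le> 4 / A"
      using A frac_le[of 1 1 "A * (1 / 4)"] by (simp add: \<rho>_def flip: su_def sv_def)
    show "0 \<le> \<rho> \<sigma>" using A su by (simp add: \<rho>_def flip: su_def sv_def)
  next
    show "continuous_on {0..S} \<rho>"
    proof -
      have "sqrt (1 - (u \<sigma>)\<^sup>2) \<noteq> 0" "sqrt (1 - (v \<sigma>)\<^sup>2) \<noteq> 0" if "\<sigma> \<in> {0..S}" for \<sigma>
        using half uv[OF that] by (smt (verit) half_gt_zero_iff)+
      then show ?thesis
        unfolding \<rho>_def using A by (intro continuous_intros) (auto simp: u_def v_def intro!: continuous_intros)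
    qed
  qed (use S in auto)
  moreover have "4 / A * (S - 0) \<le> 12 * ln A / A" using S3 A by (simp add: divide_right_mono)
  moreover have "arcsin b = pi / 3" "arcsin c = h"
    unfolding b_def c_def by (rule arcsin_sin; use h h3 pi_gt_zero in linarith)+
  ultimately show ?thesis
    using b c by (auto simp: g_def u_def v_def eS reaches_def intro: order_trans)
qed

text \<open>One step of the walk: from the midpoint of an incoming edge to that of an outgoing one.\<close>

lemma follow_edges:
  fixes A :: real
  assumes A: "19 \<le> A" and Ad: "0 \<le> A * d" "A * d \<le> 3 / 2"
    and sub: "visc_subsolution (H_plus d A) G" and cont: "continuous_on (UNIV \<times> {0..}) G"
    and sym: "flow_symmetry P L"
  shows "reaches G (P + L (vector [pi / 2, 0])) (P + L (vector [0, pi / 2])) (20 * ln A / A)"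
proof -
  have A1: "1 \<le> A" using A by simp
  have "reaches G (P + L (vector [pi / 2, 0])) (P + L (vector [0, pi / 2])) (4 / A + 12 * ln A / A + 4 / A)"
    by (rule reaches_trans[OF reaches_trans[OF climb_from_edge[OF A1 Ad sub cont sym]
        turn_corner[OF A Ad(1) sub cont sym]] descend_to_edge[OF A1 Ad sub cont sym]])
  moreover have "4 / A + 12 * ln A / A + 4 / A \<le> 20 * ln A / A"
  proof -
    have "exp 1 \<le> A" using exp_le A by linarith
    then have "1 \<le> ln A" using A by (simp add: ln_ge_iff)
    then show ?thesis using A by (simp add: field_simps)
  qed
  ultimately show ?thesis unfolding reaches_def by (meson order_trans)
qed

section \<open>Walks along the separatrices\<close>

text \<open>Points with coordinates in multiples of \<open>\<pi>/2\<close>: those with two even indices are the hyperbolic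
  stagnation points, those with one even and one odd index are the midpoints of the edges of the cells.\<close>

definition mesh_point :: "int \<Rightarrow> int \<Rightarrow> real^2" where
  "mesh_point i j = vector [of_int i * (pi / 2), of_int j * (pi / 2)]"

lemma
  fixes A :: real
  assumes A: "19 \<le> A" and Ad: "0 \<le> A * d" "A * d \<le> 3 / 2"
    and sub: "visc_subsolution (H_plus d A) G" and cont: "continuous_on (UNIV \<times> {0..}) G"
    and e: "e \<in> {1, -1}" and f: "f \<in> {1, -1}"
  shows follow_edges_even: "even (m + n) \<Longrightarrow>
      reaches G (mesh_point (2 * m + e) (2 * n)) (mesh_point (2 * m) (2 * n + f)) (20 * ln A / A)"
    and follow_edges_odd: "odd (m + n) \<Longrightarrow>
      reaches G (mesh_point (2 * m) (2 * n + f)) (mesh_point (2 * m + e) (2 * n)) (20 * ln A / A)"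
proof -
  define P :: "real^2" where "P = vector [of_int m * pi, of_int n * pi]"
  have ef: "(of_int e :: real) \<in> {1, -1}" "(of_int f :: real) \<in> {1, -1}" using e f by auto
  have pts: "mesh_point (2 * m + e) (2 * n) = P + vector [of_int e * (pi / 2), 0]"
      "mesh_point (2 * m) (2 * n + f) = P + vector [0, of_int f * (pi / 2)]"
    by (simp_all add: mesh_point_def P_def vec2_eq_iff algebra_simps)
  show "reaches G (mesh_point (2 * m + e) (2 * n)) (mesh_point (2 * m) (2 * n + f)) (20 * ln A / A)"
    if "even (m + n)"
    using follow_edges[OF A Ad sub cont flow_symmetry_even[OF that ef]] by (simp add: pts P_def)
  show "reaches G (mesh_point (2 * m) (2 * n + f)) (mesh_point (2 * m + e) (2 * n)) (20 * ln A / A)"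
    if "odd (m + n)"
    using follow_edges[OF A Ad sub cont flow_symmetry_odd[OF that ef]] by (simp add: pts P_def)
qed

lemma reaches_translates:
  fixes A :: real
  assumes A: "19 \<le> A" and Ad: "0 \<le> A * d" "A * d \<le> 3 / 2"
    and sub: "visc_subsolution (H_plus d A) G" and cont: "continuous_on (UNIV \<times> {0..}) G"
    and ij: "(i, j) \<in> {(4, 0), (-4, 0), (0, 4), (0, -4)}"
  shows "reaches G (mesh_point 1 0) (mesh_point (1 + i) j) (160 * ln A / A)"
proof -
  define b where "b = 20 * ln A / A"
  have b: "0 \<le> b" using A by (simp add: b_def)
  have even: "reaches G (mesh_point (2 * m + e) (2 * n)) (mesh_point (2 * m) (2 * n + f)) b"
    if "even (m + n)" "e \<in> {1, -1}" "f \<in> {1, -1}" for m n e f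
    unfolding b_def by (rule follow_edges_even[OF A Ad sub cont that(2,3,1)])
  have odd: "reaches G (mesh_point (2 * m) (2 * n + f)) (mesh_point (2 * m + e) (2 * n)) b"
    if "odd (m + n)" "e \<in> {1, -1}" "f \<in> {1, -1}" for m n e f
    unfolding b_def by (rule follow_edges_odd[OF A Ad sub cont that(2,3,1)])
  have more: "reaches G x y (160 * ln A / A)" if "reaches G x y c" "c \<le> 8 * b" for x y c
  proof -
    have "8 * b = 160 * ln A / A" by (simp add: b_def)
    then show ?thesis using that unfolding reaches_def by (metis order_trans)
  qed
  \<comment> \<open>Steps upward, downward, to the left and to the right. The edge \<open>(1, 0)\<close> is traversed leftward,
     so the walk to the right first turns around in the initial cell and needs eight steps.\<close>
  have u1: "reaches G (mesh_point 1 0) (mesh_point 0 1) b" using even[of 0 0 1 1] by simp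
  have u2: "reaches G (mesh_point 0 1) (mesh_point 1 2) b" using odd[of 0 1 1 "-1"] by simp
  have u3: "reaches G (mesh_point 1 2) (mesh_point 2 3) b" using even[of 1 1 "-1" 1] by simp
  have u4: "reaches G (mesh_point 2 3) (mesh_point 1 4) b" using odd[of 1 2 "-1" "-1"] by simp
  have d1: "reaches G (mesh_point 1 0) (mesh_point 0 (-1)) b" using even[of 0 0 1 "-1"] by simp
  have d2: "reaches G (mesh_point 0 (-1)) (mesh_point 1 (-2)) b" using odd[of 0 "-1" 1 1] by simp
  have d3: "reaches G (mesh_point 1 (-2)) (mesh_point 2 (-3)) b" using even[of 1 "-1" "-1" "-1"] by simp
  have d4: "reaches G (mesh_point 2 (-3)) (mesh_point 1 (-4)) b" using odd[of 1 "-2" "-1" 1] by simp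
  have l2: "reaches G (mesh_point 0 1) (mesh_point (-1) 2) b" using odd[of 0 1 "-1" "-1"] by simp
  have l3: "reaches G (mesh_point (-1) 2) (mesh_point (-2) 1) b" using even[of "-1" 1 1 "-1"] by simp
  have l4: "reaches G (mesh_point (-2) 1) (mesh_point (-3) 0) b" using odd[of "-1" 0 "-1" 1] by simp
  have r3: "reaches G (mesh_point 1 2) (mesh_point 2 1) b" using even[of 1 1 "-1" "-1"] by simp
  have r4: "reaches G (mesh_point 2 1) (mesh_point 3 0) b" using odd[of 1 0 1 1] by simp
  have r5: "reaches G (mesh_point 3 0) (mesh_point 4 1) b" using even[of 2 0 "-1" 1] by simp
  have r6: "reaches G (mesh_point 4 1) (mesh_point 5 2) b" using odd[of 2 1 1 "-1"] by simp
  have r7: "reaches G (mesh_point 5 2) (mesh_point 6 1) b" using even[of 3 1 "-1" "-1"] by simp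
  have r8: "reaches G (mesh_point 6 1) (mesh_point 5 0) b" using odd[of 3 0 "-1" 1] by simp
  note trans = reaches_trans
  note up = trans[OF trans[OF trans[OF u1 u2] u3] u4]
  note down = trans[OF trans[OF trans[OF d1 d2] d3] d4]
  note left = trans[OF trans[OF trans[OF u1 l2] l3] l4]
  note right = trans[OF trans[OF trans[OF trans[OF trans[OF trans[OF trans[OF u1 u2] r3] r4] r5] r6] r7] r8]
  from ij consider "i = 4" "j = 0" | "i = -4" "j = 0" | "i = 0" "j = 4" | "i = 0" "j = -4" by auto
  then show ?thesis
    by cases (use more[OF up] more[OF down] more[OF left] more[OF right] b in auto)
qed

section \<open>Linear decay, oscillation and limits\<close>

lemma linear_decay:
  fixes f :: "real \<Rightarrow> real"
  assumes f: "continuous_on {0..} f" and c: "0 < c" and T: "0 \<le> T" "T \<le> B"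
    and step: "\<And>t. 0 \<le> t \<Longrightarrow> f (t + T) \<le> f t - c"
  obtains K where "\<And>t. 0 \<le> t \<Longrightarrow> f t \<le> K - c / B * t"
proof -
  \<comment> \<open>A zero delay would contradict the strict decrease.\<close>
  have T0: "0 < T" using step[of 0] T c by (cases "T = 0") auto
  have "compact (f ` {0..T})"
    by (intro compact_continuous_image continuous_on_subset[OF f]) auto
  then have "bdd_above (f ` {0..T})" by (simp add: compact_imp_bounded bounded_imp_bdd_above)
  then obtain M where "\<And>y. y \<in> f ` {0..T} \<Longrightarrow> y \<le> M" unfolding bdd_above_def by blast
  then have M: "f s \<le> M" if "s \<in> {0..T}" for s using that by blast
  have iter: "f (s + real n * T) \<le> f s - real n * c" if "0 \<le> s" for s n
  proof (induction n)
    case (Suc n)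
    have "f (s + real n * T + T) \<le> f (s + real n * T) - c" by (rule step) (use that T in simp)
    then show ?case using Suc by (simp add: algebra_simps)
  qed simp
  show ?thesis
  proof
    fix t :: real assume t: "0 \<le> t"
    define n where "n = nat \<lfloor>t / T\<rfloor>"
    have n: "real n \<le> t / T" "t / T \<le> real n + 1"
      using t T0 real_of_int_floor_add_one_ge[of "t / T"] by (simp_all add: n_def)
    have s: "t - real n * T \<in> {0..T}" using n T0 by (simp add: field_simps)
    have "f t \<le> f (t - real n * T) - real n * c" using iter[of "t - real n * T" n] s by simp
    also have "\<dots> \<le> M - (t / T - 1) * c"
      using M[OF s] mult_right_mono[of "t / T - 1" "real n" c] n(2) c by linarith
    also have "\<dots> \<le> M + c - c / B * t"
    proof -
      have "c / B * t \<le> c / T * t" using T T0 c t by (intro mult_right_mono divide_left_mono) auto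
      then show ?thesis by (simp add: algebra_simps)
    qed
    finally show "f t \<le> M + c - c / B * t" .
  qed
qed

lemma planar_solution_decay:
  fixes A :: real
  assumes A: "19 \<le> A" and Ad: "0 \<le> A * d" "A * d \<le> 3 / 2" and p: "norm p = 1"
    and sol: "planar_visc_solution (H_plus d A) p u\<^sub>0 G"
  obtains K where "\<And>t. 0 \<le> t \<Longrightarrow> G (vector [pi/2, 0], t) \<le> K - pi / (160 * ln A / A) * t"
proof -
  have sub: "visc_subsolution (H_plus d A) G" and cont: "continuous_on (UNIV \<times> {0..}) G"
    and per: "\<And>t. 0 \<le> t \<Longrightarrow> torus_periodic (\<lambda>x. G (x, t) - p \<bullet> x)"
    using sol by (auto simp: planar_visc_solution_def)
  \<comment> \<open>One of the four unit lattice vectors has inner product at least \<open>1/2\<close> with \<open>p\<close>.\<close>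
  have "1 / 2 \<le> \<bar>p$1\<bar> \<or> 1 / 2 \<le> \<bar>p$2\<bar>"
    using norm_le_l1_cart[of p] p unfolding sum_2 by linarith
  then have "1 / 2 \<le> p$1 \<or> 1 / 2 \<le> - p$1 \<or> 1 / 2 \<le> p$2 \<or> 1 / 2 \<le> - p$2" by linarith
  then have "\<exists>(i, j) \<in> {(1, 0), (-1, 0), (0, 1), (0, -1)}. 1 / 2 \<le> of_int i * p$1 + of_int j * p$2"
    by simp
  then obtain i j :: int where ij: "(i, j) \<in> {(1, 0), (-1, 0), (0, 1), (0, -1)}"
    and pij: "1 / 2 \<le> of_int i * p$1 + of_int j * p$2"
    by blast
  have pt: "mesh_point 1 0 = vector [pi/2, 0]" by (simp add: mesh_point_def vec2_eq_iff)
  define k :: "int^2" where "k = vector [i, j]"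
  have shift: "mesh_point (1 + 4 * i) (4 * j) = mesh_point 1 0 + (\<chi> l. 2 * pi * of_int (k $ l))"
    by (simp add: mesh_point_def vec2_eq_iff k_def algebra_simps)
  have "reaches G (mesh_point 1 0) (mesh_point (1 + 4 * i) (4 * j)) (160 * ln A / A)"
    by (rule reaches_translates[OF A Ad sub cont]) (use ij in auto)
  then obtain T where T: "0 \<le> T" "T \<le> 160 * ln A / A"
    and le: "\<And>t. 0 \<le> t \<Longrightarrow> G (mesh_point (1 + 4 * i) (4 * j), t + T) \<le> G (mesh_point 1 0, t)"
    unfolding reaches_def by blast
  show ?thesis
  proof (rule linear_decay[of "\<lambda>t. G (vector [pi/2, 0], t)" pi T "160 * ln A / A"])
    show "continuous_on {0..} (\<lambda>t. G (vector [pi/2, 0], t))"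
      by (intro continuous_on_compose2[OF cont] continuous_intros) auto
    fix t :: real assume t: "0 \<le> t"
    \<comment> \<open>The walk ends at the translate by \<open>2 \<pi> (i, j)\<close>, whose value exceeds the one at the start by at
       least \<open>\<pi>\<close> at every time.\<close>
    have "G (mesh_point (1 + 4 * i) (4 * j), t + T) - p \<bullet> mesh_point (1 + 4 * i) (4 * j)
        = G (mesh_point 1 0, t + T) - p \<bullet> mesh_point 1 0"
      unfolding shift using per[of "t + T"] t T unfolding torus_periodic_def by auto
    moreover have "p \<bullet> mesh_point (1 + 4 * i) (4 * j) = p \<bullet> mesh_point 1 0
        + 2 * pi * (of_int i * p$1 + of_int j * p$2)"
      by (simp add: mesh_point_def inner_vec_def sum_2 algebra_simps)
    moreover have "2 * pi * (1 / 2) \<le> 2 * pi * (of_int i * p$1 + of_int j * p$2)"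
      by (intro mult_left_mono pij) simp
    ultimately show "G (vector [pi/2, 0], t + T) \<le> G (vector [pi/2, 0], t) - pi"
      using le[OF t] unfolding pt by linarith
  qed (use T that in auto)
qed

lemma torus_periodic_bounded:
  assumes "continuous_on UNIV f" "torus_periodic f"
  shows "bdd_above (range f)" "bdd_below (range f)"
proof -
  have "range f \<subseteq> f ` cbox 0 (\<chi> i. 2 * pi)"
  proof
    fix y assume "y \<in> range f"
    then obtain x where x: "y = f x" by blast
    obtain k :: "int^2" where "x + (\<chi> i. 2 * pi * of_int (k$i)) \<in> cbox 0 (\<chi> i. 2 * pi)"
      by (rule translate_into_cell)
    moreover have "f (x + (\<chi> i. 2 * pi * of_int (k$i))) = y"
      using assms(2) x by (simp add: torus_periodic_def)
    ultimately show "y \<in> f ` cbox 0 (\<chi> i. 2 * pi)" by (metis imageI)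
  qed
  moreover have "bounded (f ` cbox 0 (\<chi> i. 2 * pi))"
    by (intro compact_imp_bounded compact_continuous_image continuous_on_subset[OF assms(1)] compact_cbox) auto
  ultimately have "bounded (range f)" using bounded_subset by blast
  then show "bdd_above (range f)" "bdd_below (range f)"
    by (simp_all add: bounded_imp_bdd_above bounded_imp_bdd_below)
qed

lemma diff_le_osc:
  assumes "continuous_on UNIV f" "torus_periodic f"
  shows "f x - f y \<le> osc f"
  using cSUP_upper[OF UNIV_I torus_periodic_bounded(1)[OF assms], of x]
    cINF_lower[OF torus_periodic_bounded(2)[OF assms] UNIV_I, of y]
  by (simp add: osc_def)

lemma Liminf_at_top_ge:
  fixes f :: "real \<Rightarrow> real"
  assumes f: "\<And>t. 0 \<le> t \<Longrightarrow> r * t - K \<le> f t" and s: "s < r"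
  shows "ereal s \<le> Liminf at_top (\<lambda>t. ereal (f t / t))"
proof (rule Liminf_bounded)
  show "\<forall>\<^sub>F t in at_top. ereal s \<le> ereal (f t / t)"
    using eventually_ge_at_top[of "max 1 (K / (r - s))"]
  proof eventually_elim
    case (elim t)
    then have "1 \<le> t" "K \<le> (r - s) * t" using s by (auto simp: field_simps)
    then show ?case using f[of t] by (simp add: field_simps)
  qed
qed

lemma planar_comparison:
  assumes sol1: "planar_visc_solution (H_plus d A) p u1 G1"
    and sol2: "planar_visc_solution (H_plus d A) p u2 G2"
    and M: "\<And>x. u1 x - u2 x \<le> M" and t: "0 \<le> t"
  shows "G1 (x, t) - G2 (x, t) \<le> M"
proof (rule comparison[OF _ _ _ _ H_plus_lipschitz])
  fix x y :: "real^2" and t s :: real and k :: "int^2"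
  assume t: "0 \<le> t" "0 \<le> s"
  have "torus_periodic (\<lambda>x. G1 (x, t) - p \<bullet> x)" "torus_periodic (\<lambda>x. G2 (x, s) - p \<bullet> x)"
    using sol1 sol2 t by (auto simp: planar_visc_solution_def)
  from this(1)[unfolded torus_periodic_def, rule_format, of x k]
    this(2)[unfolded torus_periodic_def, rule_format, of y k]
  show "G1 (x + (\<chi> i. 2 * pi * of_int (k$i)), t) - G2 (y + (\<chi> i. 2 * pi * of_int (k$i)), s)
      = G1 (x, t) - G2 (y, s)"
    by (simp add: inner_add_right)
next
  show "G1 (x, 0) - G2 (x, 0) \<le> M" for x
    using sol1 sol2 M[of x] by (simp add: planar_visc_solution_def)
qed (use sol1 sol2 t in \<open>auto simp: planar_visc_solution_def\<close>)

theorem corollary2p2: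
  shows "\<exists>C::real. C > 0 \<and>
    (\<forall>(d::real) (A::real) (\<mu>::real) (p::real^2) (u\<^sub>0 :: real^2 \<Rightarrow> real)
       (G :: (real^2) \<times> real \<Rightarrow> real) (Gu :: (real^2) \<times> real \<Rightarrow> real).
      \<mu> = A * d \<longrightarrow> 0 < d \<longrightarrow> d < 20/399 \<longrightarrow> sqrt (1 + 4 * d^2) < \<mu> \<longrightarrow> \<mu> \<le> 1 + d/10 \<longrightarrow>
      norm p = 1 \<longrightarrow> continuous_on UNIV u\<^sub>0 \<longrightarrow> torus_periodic u\<^sub>0 \<longrightarrow>
      planar_visc_solution (H_plus d A) p (\<lambda>x. 0) G \<longrightarrow>
      planar_visc_solution (H_plus d A) p u\<^sub>0 Gu \<longrightarrow>
      (\<forall>x. \<forall>t\<ge>0. G (x, t) + (INF y. u\<^sub>0 y) \<le> Gu (x, t) \<and> Gu (x, t) \<le> G (x, t) + (SUP y. u\<^sub>0 y)) \<and>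
      (\<forall>x \<in> flat_segment \<mu>. \<forall>t\<ge>0.
         Gu (x, t) \<ge> pi * p$1 - arccos (1/\<mu>) * \<bar>p$1\<bar> + (INF y. u\<^sub>0 y)) \<and>
      Liminf at_top (\<lambda>t. ereal (- Gu (vector [pi/2, 0], t) / t)) \<ge> ereal (C * (A / ln A)) \<and>
      Liminf at_top (\<lambda>t. ereal (osc (\<lambda>x. Gu (x, t) - p \<bullet> x) / t)) \<ge> ereal (C * (A / ln A)))"
proof (intro exI[of _ "1 / 160"] conjI allI ballI impI)
  show "(0::real) < 1 / 160" by simp
next
  fix d A \<mu> :: real and p :: "real^2" and u\<^sub>0 G Gu
  assume \<mu>_def: "\<mu> = A * d" and d: "0 < d" "d < 20 / 399" and \<mu>: "sqrt (1 + 4 * d\<^sup>2) < \<mu>" "\<mu> \<le> 1 + d / 10"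
    and p: "norm p = 1" and u0: "continuous_on UNIV u\<^sub>0" "torus_periodic u\<^sub>0"
    and G: "planar_visc_solution (H_plus d A) p (\<lambda>x. 0) G"
    and Gu: "planar_visc_solution (H_plus d A) p u\<^sub>0 Gu"
  define r where "r = arccos (1 / \<mu>)"
  have INF_le: "(INF y. u\<^sub>0 y) \<le> u\<^sub>0 x" and le_SUP: "u\<^sub>0 x \<le> (SUP y. u\<^sub>0 y)" for x
    using torus_periodic_bounded[OF u0] by (auto intro: cINF_lower cSUP_upper)
  show "G (x, t) + (INF y. u\<^sub>0 y) \<le> Gu (x, t)" if "0 \<le> t" for x t
    using planar_comparison[OF G Gu _ that, of "- (INF y. u\<^sub>0 y)" x] INF_le by simp
  show "Gu (x, t) \<le> G (x, t) + (SUP y. u\<^sub>0 y)" if "0 \<le> t" for x t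
    using planar_comparison[OF Gu G _ that, of "SUP y. u\<^sub>0 y" x] le_SUP by simp
  have cont: "continuous_on (UNIV \<times> {0..}) Gu" and super: "visc_supersolution (H_plus d A) Gu"
    and per: "\<And>t. 0 \<le> t \<Longrightarrow> torus_periodic (\<lambda>x. Gu (x, t) - p \<bullet> x)"
    and init: "\<And>x. Gu (x, 0) = p \<bullet> x + u\<^sub>0 x"
    using Gu by (auto simp: planar_visc_solution_def)
  have seg: "pi * p$1 - r * \<bar>p$1\<bar> + (INF y. u\<^sub>0 y) \<le> Gu (x, t)"
    if x: "x \<in> flat_segment \<mu>" and t: "0 \<le> t" for x t
  proof (rule supersolution_barrier[OF super cont H_plus_lipschitz _ flat_segment_compact
        flat_segment_convex _ _ x t])
    show "H_plus d A x q \<le> 0" if "x \<in> flat_segment \<mu>" "\<And>y. y \<in> flat_segment \<mu> \<Longrightarrow> 0 \<le> q \<bullet> (y - x)" for x q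
      using H_plus_flat_segment_nonpos[of d A x q] that d \<mu> by (simp add: \<mu>_def)
    show "pi * p$1 - r * \<bar>p$1\<bar> + (INF y. u\<^sub>0 y) \<le> Gu (x, 0)" if "x \<in> flat_segment \<mu>" for x
    proof -
      have x: "\<bar>x$1 - pi\<bar> \<le> r" "x$2 = 0" using that by (auto simp: flat_segment_def r_def)
      have "\<bar>(x$1 - pi) * p$1\<bar> \<le> r * \<bar>p$1\<bar>" unfolding abs_mult by (intro mult_right_mono x) simp
      moreover have "p \<bullet> x = pi * p$1 + (x$1 - pi) * p$1"
        using x by (simp add: inner_vec_def sum_2 algebra_simps)
      ultimately show ?thesis using INF_le[of x] unfolding init by linarith
    qed
  qed simp
  show "pi * p$1 - arccos (1/\<mu>) * \<bar>p$1\<bar> + (INF y. u\<^sub>0 y) \<le> Gu (x, t)"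
    if "x \<in> flat_segment \<mu>" "0 \<le> t" for x t
    using seg[OF that] by (simp add: r_def)
  have "1 \<le> sqrt (1 + 4 * d\<^sup>2)" by simp
  then have \<mu>1: "1 < \<mu>" using \<mu> by linarith
  have A: "19 \<le> A"
  proof (rule ccontr)
    assume "\<not> 19 \<le> A"
    then have "A * d \<le> 19 * d" using d by (intro mult_right_mono) auto
    then show False using \<mu>1[unfolded \<mu>_def] d by linarith
  qed
  have Ad: "0 \<le> A * d" "A * d \<le> 3 / 2" using \<mu>1 \<mu> d by (simp_all flip: \<mu>_def)
  define rate where "rate = pi / (160 * ln A / A)"
  obtain K where "\<And>t. 0 \<le> t \<Longrightarrow> Gu (vector [pi/2, 0], t) \<le> K - pi / (160 * ln A / A) * t"
    by (rule planar_solution_decay[OF A Ad p Gu]) (rule that)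
  then have K: "\<And>t. 0 \<le> t \<Longrightarrow> Gu (vector [pi/2, 0], t) \<le> K - rate * t" unfolding rate_def .
  \<comment> \<open>The margin \<open>\<pi> > 1\<close> absorbs the bounded terms in the limits.\<close>
  have rate: "1 / 160 * (A / ln A) < rate"
    using A pi_gt3 by (simp add: rate_def field_simps)
  show "ereal (1 / 160 * (A / ln A)) \<le> Liminf at_top (\<lambda>t. ereal (- Gu (vector [pi/2, 0], t) / t))"
    by (rule Liminf_at_top_ge[OF _ rate, of K]) (use K in force)
  define c where "c = pi * p$1 - r * \<bar>p$1\<bar> + (INF y. u\<^sub>0 y) - p \<bullet> vector [pi, 0] + p \<bullet> vector [pi/2, 0]"
  have "0 < 1 / \<mu>" "1 / \<mu> < 1" using \<mu>1 by simp_all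
  then have "0 \<le> r" unfolding r_def by (intro arccos_lbound; linarith)
  then have mid: "vector [pi, 0] \<in> flat_segment \<mu>" by (simp add: flat_segment_def r_def)
  show "ereal (1 / 160 * (A / ln A)) \<le> Liminf at_top (\<lambda>t. ereal (osc (\<lambda>x. Gu (x, t) - p \<bullet> x) / t))"
  proof (rule Liminf_at_top_ge[OF _ rate, of "K - c"])
    fix t :: real assume t: "0 \<le> t"
    have "continuous_on UNIV (\<lambda>x. Gu (x, t) - p \<bullet> x)"
      by (intro continuous_intros continuous_on_compose2[OF cont]) (use t in auto)
    from diff_le_osc[OF this per[OF t], of "vector [pi, 0]" "vector [pi/2, 0]"]
    show "rate * t - (K - c) \<le> osc (\<lambda>x. Gu (x, t) - p \<bullet> x)"
      using seg[OF mid t] K[OF t] by (simp add: c_def)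
  qed
qed

end
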